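(* Let $f(n)$ ($n\ge1$) be a sequence, let $\kappa_0\in\mathbb{R}\setminus\{0\}$ and $\kappa\in\mathbb{C}$ with $\operatorname{Re}\kappa>\kappa_0>-1$, let $\delta>0$ and $q>1$ be real numbers with $\delta\le\pi/\log q$ and $\delta<\operatorname{Re}\kappa-\kappa_0$, and let $m$ be a positive integer. Let $\Phi_0,\dots,\Phi_{m-1}$ be $1$-periodic functions, Hölder continuous with exponent $\alpha$ where $\operatorname{Re}\kappa-\kappa_0<\alpha\le1$, such that $$F(N)=\sum_{1\le n<N}f(n)=\sum_{0\le k<m}N^\kappa(\log_qN)^k\Phi_k(\{\log_qN\})+O(N^{\kappa_0})$$ for integers $N\to\infty$. For $\mathcal{F}(s)=\sum_{n\ge1}n^{-s}f(n)$ assume: (i) there is a real $\sigma_a\ge\operatorname{Re}\kappa$ such that $\mathcal{F}(s)$ converges absolutely for $\operatorname{Re}s>\sigma_a$; (ii) $\mathcal{F}$ can be continued to a meromorphic function on $\operatorname{Re}s>\kappa_0-\delta$ whose poles can only occur at $\kappa+\chi_\ell$, $\ell\in\mathbb{Z}$, and have order at most $m$; (iii) there is a real $\eta>0$ such that $\mathcal{F}(s)=O(|\operatorname{Im}s|^\eta)$ as $|\operatorname{Im}s|\to\infty$ for $\kappa_0\le\operatorname{Re}s\le\sigma_a$ with $|s-\kappa-\chi_\ell|\ge\delta$ for all $\ell\in\mathbb{Z}$. Then for $u\in\mathbb{R}$ and $0\le k<m$, $\Phi_k(u)=\sum_{\ell\in\mathbb{Z}}\varphi_{k\ell}\exp(2\ell\pi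 iu)$ with $$\varphi_{k\ell}=\frac{(\log q)^k}{k!}\operatorname*{Res}_{s=\kappa+\chi_\ell}\frac{\mathcal{F}(s)(s-\kappa-\chi_\ell)^k}{s}.$$ If moreover $-1<\kappa_0<0$ and $\kappa\notin\frac{2\pi i}{\log q}\mathbb{Z}$, then $\mathcal{F}(0)=0$.
   Context: $\chi_\ell=\frac{2\pi i\ell}{\log q}$ for $\ell\in\mathbb{Z}$; $\{z\}$ is the fractional part; $\log_qN=\log N/\log q$. Implicit $O$-constants may depend on $f,q,m,\kappa,\kappa_0,\alpha,\delta,\sigma_a,\eta$. *)

theory Defs
  imports "HOL-Complex_Analysis.Complex_Analysis"
begin

definition chi :: "real \<Rightarrow> int \<Rightarrow> complex" where
  "chi q l = 2 * pi * \<i> * of_int l / of_real (ln q)"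

definition holder_continuous :: "real \<Rightarrow> (real \<Rightarrow> complex) \<Rightarrow> bool" where
  "holder_continuous \<alpha> g \<longleftrightarrow> (\<exists>C. \<forall>x y. norm (g x - g y) \<le> C * \<bar>x - y\<bar> powr \<alpha>)"

end

theory Submission
  imports Defs
begin

text \<open>Write $L = \log q$, $F(N) = \sum_{n<N} f(n)$ and let $A(u)$ be the main term of $F$ at $N = q^u$.
  Abel summation turns the Dirichlet series into $sL \int_0^\infty F e^{-sLu}\,du$, with $F$ a step function of $q^u$.
  Since the exponent $\alpha$ exceeds $\mathrm{Re}\,\kappa - \kappa_0$, replacing $F$ by $A$ costs $O(q^{\kappa_0 u})$
  uniformly in $u$, hence a function $H$ holomorphic for $\mathrm{Re}\,s > \kappa_0$. The transform of the term
  $u^k \Phi_k(u)$ is $(-1/L)^k$ times the $k$-th derivative of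
  $\int_0^1 \Phi_k(u) e^{-zLu}\,du / (1 - e^{-Lz})$ at $z = s - \kappa$, so it extends to the plane with
  a pure pole of order $k+1$ at each $\chi_\ell$ whose coefficient is a multiple of the Fourier coefficient of $\Phi_k$.
  By uniqueness of continuation $\mathcal F(s)$ is $s$ times an explicit function, which gives the residues and
  also $\mathcal F(0) = 0$. Hoelder continuity makes the Fourier series converge pointwise.\<close>

section \<open>Fourier series of Hoelder continuous functions\<close>

text \<open>The condition on \<alpha> comes from comparing two rates. Near height u the points log_q
  n are about q^(-u)/L apart. The main term is O(q^(\<beta> u)) for every \<beta> > Re \<kappa>, the
  slack absorbing the powers of u, so between neighbouring points it moves by O(q^((\<beta> -
  \<alpha>) u)). The choice \<beta> = \<open>\<kappa>0 + \<alpha>\<close> is admissible because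
  \<alpha> > Re \<kappa> - \<open>\<kappa>0\<close>, and it makes this movement as small as the
  given error. Thus an expansion known only at integers holds along the whole step function.

  The denominator 1 - exp(-Lz) is a geometric series: a shift by one period multiplies the integrand
  by exp(-Lz). Purity of the poles separates the functions \<open>\<Phi> k\<close>: the k-th term
  contributes only the power (s - p)^(-k-1), so the weight (s - p)^j in the residue sees
  \<open>\<Phi> j\<close> alone. The factor s from Abel summation cancels the division by s in the
  residue, hence a pole at p = 0 is no exception.\<close>

lemma integrable_continuous_UNIV:
  fixes h :: "real \<Rightarrow> complex"
  assumes "continuous_on UNIV h"
  shows "h integrable_on {a..b}"
  using assms by (meson continuous_on_subset integrable_continuous_real top_greatest)

lemma periodic_add_of_int:
  fixes h :: "real \<Rightarrow> 'a"
  assumes per: "\<And>x. h (x + 1) = h x"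
  shows "h (x + of_int n) = h x"
proof -
  have nat: "h (x + real n) = h x" for x n
  proof (induction n)
    case (Suc n)
    then show ?case using per[of "x + real n"] by (simp add: add_ac)
  qed simp
  show ?thesis
    using nat[of x "nat n"] nat[of "x + of_int n" "nat (- n)"] by (cases "n \<ge> 0") auto
qed

lemma periodic_frac:
  fixes h :: "real \<Rightarrow> 'a"
  assumes per: "\<And>x. h (x + 1) = h x"
  shows "h (frac x) = h x"
  using periodic_add_of_int[of h "frac x" "\<lfloor>x\<rfloor>", OF per] by (simp add: frac_def)

text \<open>An integer shift reduces to a start r in [0, 1); the overhang [1, r + 1] then moves back
  by one period to [0, r].\<close>

lemma integral_periodic:
  fixes h :: "real \<Rightarrow> complex"
  assumes h: "continuous_on UNIV h" and per: "\<And>x. h (x + 1) = h x"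
  shows "integral {a..a + 1} h = integral {0..1} h"
proof -
  have int: "h (x + of_int n) = h x" for x n
    by (rule periodic_add_of_int[of h, OF per])
  define r where "r = frac a"
  have r: "0 \<le> r" "r \<le> 1" "a = r + of_int \<lfloor>a\<rfloor>"
    by (auto simp: r_def frac_def) linarith
  have "integral {a..a + 1} h = integral {a - of_int \<lfloor>a\<rfloor>..a + 1 - of_int \<lfloor>a\<rfloor>} (\<lambda>x. h (x + of_int \<lfloor>a\<rfloor>))"
    by (simp only: integral_shift_real_ivl)
  also have "\<dots> = integral {r..r + 1} h"
  proof -
    have "a - of_int \<lfloor>a\<rfloor> = r" "a + 1 - of_int \<lfloor>a\<rfloor> = r + 1" by (auto simp: r_def frac_def)
    then show ?thesis by (simp only: int)
  qed
  also have "\<dots> = integral {r..1} h + integral {1..r+1} h"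
    using r by (intro Henstock_Kurzweil_Integration.integral_combine [symmetric] integrable_continuous_UNIV h) auto
  also have "integral {1..r+1} h = integral {1 - 1..r + 1 - 1} (\<lambda>x. h (x + 1))"
    by (simp only: integral_shift_real_ivl)
  also have "\<dots> = integral {0..r} h" by (simp add: per)
  also have "integral {r..1} h + integral {0..r} h = integral {0..1} h"
    using r by (subst add.commute, intro Henstock_Kurzweil_Integration.integral_combine integrable_continuous_UNIV h) auto
  finally show ?thesis .
qed

lemma has_vector_derivative_exp_of_real:
  fixes c :: complex
  shows   "((\<lambda>x. exp (c * of_real x)) has_vector_derivative c * exp (c * of_real x)) (at x within S)"
proof -
  have "((\<lambda>z. exp (c * z)) has_field_derivative c * exp (c * of_real x)) (at (of_real x))"
    by (rule derivative_eq_intros refl | simp add: mult_ac)+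
  then show ?thesis by (rule has_vector_derivative_real_field)
qed

text \<open>Continuity alone does not allow integration by parts, so g is replaced by a uniformly
  close polynomial function p; for p, integration by parts gives a bound K / |t|.\<close>

lemma riemann_lebesgue_continuous:
  fixes g :: "real \<Rightarrow> complex"
  assumes g: "continuous_on {a..b} g"
  shows "((\<lambda>t. integral {a..b} (\<lambda>x. g x * exp (\<i> * of_real (t * x)))) \<longlongrightarrow> 0) at_infinity"
proof (cases "a \<le> b")
  case True
  show ?thesis
  proof (rule tendstoI)
    fix e :: real assume "e > 0"
    \<comment> \<open>The approximation error costs at most e' (b - a) < e / 2; the summand 1 covers
      a = b.\<close>
    define e' where "e' = e / (2 * (b - a + 1))"
    have e': "e' > 0" "e' * (b - a) < e / 2"
      using True \<open>e > 0\<close> by (auto simp: e'_def divide_simps)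
    obtain p where p: "polynomial_function p" "\<And>x. x \<in> {a..b} \<Longrightarrow> norm (g x - p x) < e'"
      using Stone_Weierstrass_polynomial_function[OF _ g \<open>e' > 0\<close>] by auto
    obtain p' where p': "polynomial_function p'" "\<And>x. (p has_vector_derivative p' x) (at x)"
      using has_vector_derivative_polynomial_function[OF p(1)] by blast
    note cont = continuous_on_polymonial_function[OF p(1)] continuous_on_polymonial_function[OF p'(1)]
    have "compact (p' ` {a..b})"
      by (intro compact_continuous_image cont) auto
    then have "bounded (p' ` {a..b})" by (rule compact_imp_bounded)
    then obtain B where B: "\<And>x. x \<in> {a..b} \<Longrightarrow> norm (p' x) \<le> B" "B > 0"
      by (metis bounded_pos image_eqI)
    define K where "K = norm (p b) + norm (p a) + B * (b - a)"
    have K: "K \<ge> 0" using True B by (simp add: K_def)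
    have main: "norm (integral {a..b} (\<lambda>x. g x * exp (\<i> * of_real (t * x)))) \<le> e / 2 + K / \<bar>t\<bar>"
      if "t \<noteq> 0" for t
    proof -
      define E where "E = (\<lambda>x. exp (\<i> * of_real (t * x)))"
      have E: "norm (E x) = 1" for x by (simp add: E_def del: of_real_mult)
      have cE: "continuous_on S E" for S unfolding E_def by (intro continuous_intros)
      have dE: "(E has_vector_derivative \<i> * t * E x) (at x)" for x
        using has_vector_derivative_exp_of_real[of "\<i> * t" x UNIV] by (simp add: E_def mult_ac)
      have "((\<lambda>x. p x * (E x / (\<i> * t))) has_vector_derivative (p' x * (E x / (\<i> * t)) + p x * E x)) (at x)" for x
      proof -
        have "((\<lambda>x. E x / (\<i> * t)) has_vector_derivative \<i> * t * E x / (\<i> * t)) (at x)"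
          by (rule has_vector_derivative_divide[OF dE])
        then have "((\<lambda>x. E x / (\<i> * t)) has_vector_derivative E x) (at x)" using that by simp
        from has_vector_derivative_mult[OF p'(2) this] show ?thesis by (simp add: add_ac)
      qed
      then have H: "((\<lambda>x. p' x * (E x / (\<i> * t)) + p x * E x) has_integral
          p b * (E b / (\<i> * t)) - p a * (E a / (\<i> * t))) {a..b}"
        by (intro fundamental_theorem_of_calculus True) (auto intro: has_vector_derivative_at_within)
      have i1: "(\<lambda>x. p' x * (E x / (\<i> * t))) integrable_on {a..b}"
        using that by (intro integrable_continuous_real continuous_intros cont cE) auto
      have eq: "integral {a..b} (\<lambda>x. p x * E x) =
           p b * (E b / (\<i> * t)) - p a * (E a / (\<i> * t)) - integral {a..b} (\<lambda>x. p' x * (E x / (\<i> * t)))"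
        using has_integral_diff[OF H integrable_integral[OF i1]] by (simp add: integral_unique)
      have "norm (integral {a..b} (\<lambda>x. p' x * (E x / (\<i> * t)))) \<le> B / \<bar>t\<bar> * (b - a)"
        using that B True
        by (intro integral_bound continuous_intros cont cE) (auto simp: norm_mult norm_divide E divide_right_mono)
      moreover have "norm (p b * (E b / (\<i> * t))) = norm (p b) / \<bar>t\<bar>" "norm (p a * (E a / (\<i> * t))) = norm (p a) / \<bar>t\<bar>"
        by (auto simp: norm_mult norm_divide E)
      ultimately have 1: "norm (integral {a..b} (\<lambda>x. p x * E x)) \<le> K / \<bar>t\<bar>"
        unfolding eq K_def add_divide_distrib
        by (smt (verit) norm_triangle_ineq4 times_divide_eq_left)
      have "norm (integral {a..b} (\<lambda>x. (g x - p x) * E x)) \<le> e' * (b - a)"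
        using p(2) True by (intro integral_bound continuous_intros cont cE g) (auto simp: norm_mult E less_imp_le)
      moreover have "integral {a..b} (\<lambda>x. g x * E x) = integral {a..b} (\<lambda>x. (g x - p x) * E x) + integral {a..b} (\<lambda>x. p x * E x)"
        by (subst Henstock_Kurzweil_Integration.integral_add [symmetric])
           (auto intro!: integrable_continuous_real continuous_intros cont cE g simp: algebra_simps)
      ultimately have "norm (integral {a..b} (\<lambda>x. g x * E x)) \<le> e' * (b - a) + K / \<bar>t\<bar>"
        using 1 norm_triangle_ineq order_trans by (smt (verit))
      then show ?thesis using e' by (simp add: E_def)
    qed
    have "eventually (\<lambda>t::real. norm t \<ge> 4 * K / e + 1) at_infinity"
      by (auto simp: eventually_at_infinity)
    then show "\<forall>\<^sub>F t in at_infinity. dist (integral {a..b} (\<lambda>x. g x * exp (\<i> * of_real (t * x)))) 0 < e"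
    proof eventually_elim
      case (elim t)
      have t: "\<bar>t\<bar> > 4 * K / e" using elim by simp
      then have "t \<noteq> 0" using K \<open>e > 0\<close> by (auto simp: field_simps)
      have "K / \<bar>t\<bar> \<le> e / 4" using t K \<open>e > 0\<close> \<open>t \<noteq> 0\<close> by (simp add: field_simps)
      then have "norm (integral {a..b} (\<lambda>x. g x * exp (\<i> * of_real (t * x)))) < e"
        using main[OF \<open>t \<noteq> 0\<close>] \<open>e > 0\<close> by linarith
      then show ?case unfolding dist_norm diff_0_right .
    qed
  qed
qed auto

text \<open>The modulus is 2 |sin (pi x)|, and the cubic Taylor bound gives sin y >= y / 3 on
  [0, 2]. A crude constant is enough: only the order 1/x of the Dirichlet kernel at 0
  matters.\<close>

lemma norm_exp_2pi_minus_1_ge: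
  assumes "0 \<le> x" "x \<le> 1/2"
  shows "norm (exp (2 * pi * \<i> * of_real x) - 1) \<ge> x"
proof -
  have "norm (exp (2 * pi * \<i> * of_real x) - 1) = norm (exp (\<i> * of_real (2 * pi * x)) - 1)"
    by (simp add: mult_ac)
  also have "\<dots> = 2 * \<bar>sin (pi * x)\<bar>" by (subst dist_exp_i_1) simp
  finally have eq: "norm (exp (2 * pi * \<i> * of_real x) - 1) = 2 * \<bar>sin (pi * x)\<bar>" .
  define y where "y = pi * x"
  have y: "0 \<le> y" "y \<le> 2" using assms pi_less_4 mult_mono[of pi 4 x "1/2"] by (auto simp: y_def)
  have "\<bar>sin y - (\<Sum>m<3. sin_coeff m * y ^ m)\<bar> \<le> inverse (fact 3) * \<bar>y\<bar> ^ 3"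
    by (rule Maclaurin_sin_bound)
  also have "(\<Sum>m<3. sin_coeff m * y ^ m) = y" by (simp add: sin_coeff_def eval_nat_numeral)
  also have "inverse (fact 3) * \<bar>y\<bar> ^ 3 = y * y^2 / 6" using y by (simp add: eval_nat_numeral)
  also have "\<dots> \<le> y * 2^2/6" using y by (intro divide_right_mono mult_left_mono power_mono) auto
  finally have "\<bar>sin y - y\<bar> \<le> y * 2\<^sup>2 / 6" .
  then have "\<bar>sin y - y\<bar> \<le> 2 * y / 3" by simp
  then have "sin y \<ge> y / 3" by linarith
  moreover have "y \<ge> 3 * x" using assms pi_gt3 by (simp add: y_def mult_right_mono)
  ultimately show ?thesis unfolding eq y_def[symmetric] using assms by linarith
qed

section \<open>The Dirichlet kernel and partial sums of Fourier series\<close>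

definition dirichlet_kernel :: "nat \<Rightarrow> real \<Rightarrow> complex" where
  "dirichlet_kernel L x = (\<Sum>l\<in>{-int L..int L}. exp (2 * of_int l * pi * \<i> * of_real x))"

lemma dirichlet_kernel_minus: "dirichlet_kernel L (- x) = dirichlet_kernel L x"
  unfolding dirichlet_kernel_def
  by (rule sum.reindex_bij_witness[of _ uminus uminus]) auto

lemma dirichlet_kernel_add_1: "dirichlet_kernel L (x + 1) = dirichlet_kernel L x"
  unfolding dirichlet_kernel_def
proof (rule sum.cong)
  fix l
  have "exp (2 * of_int l * pi * \<i> * of_real (x + 1)) = exp (2 * of_int l * pi * \<i> * of_real x + \<i> * (of_int l * (of_real pi * 2)))"
    by (simp add: algebra_simps)
  then show "exp (2 * of_int l * pi * \<i> * of_real (x + 1)) = exp (2 * of_int l * pi * \<i> * of_real x)"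
    by (simp only: exp_plus_2pin)
qed simp

lemma continuous_on_dirichlet_kernel [continuous_intros]:
  "continuous_on S g \<Longrightarrow> continuous_on S (\<lambda>x. dirichlet_kernel L (g x))"
  unfolding dirichlet_kernel_def by (intro continuous_intros)

text \<open>Multiplying by the ratio minus 1 collapses the geometric sum without any division. Both
  exponentials are written as exp(i t x) with real t, the shape to which the Riemann-Lebesgue lemma
  applies.\<close>

lemma dirichlet_kernel_telescope:
  "(exp (2 * pi * \<i> * of_real x) - 1) * dirichlet_kernel L x =
     exp (\<i> * of_real ((2 * pi * (real L + 1)) * x)) - exp (\<i> * of_real ((- 2 * pi * real L) * x))"
proof -
  define e where "e = (\<lambda>l::int. exp (2 * of_int l * pi * \<i> * of_real x))"
  have "(exp (2 * pi * \<i> * of_real x) - 1) * dirichlet_kernel L x = (\<Sum>l\<in>{-int L..int L}. e (l + 1) - e l)"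
    unfolding dirichlet_kernel_def e_def sum_distrib_left
    by (intro sum.cong refl) (simp add: algebra_simps exp_add)
  also have "\<dots> = e (int L + 1) - e (- int L)"
  proof (induction L)
    case (Suc L)
    have "{-int (Suc L)..int (Suc L)} = insert (-int (Suc L)) (insert (int (Suc L)) {-int L..int L})" by auto
    then show ?case using Suc by (simp add: algebra_simps)
  qed simp
  also have "\<dots> = exp (\<i> * of_real ((2 * pi * (real L + 1)) * x)) - exp (\<i> * of_real ((- 2 * pi * real L) * x))"
    by (simp add: e_def algebra_simps)
  finally show ?thesis .
qed

definition fourier_coeff :: "(real \<Rightarrow> complex) \<Rightarrow> int \<Rightarrow> complex" where
  "fourier_coeff \<phi> l = integral {0..1} (\<lambda>x. \<phi> x * exp (- (2 * of_int l * pi * \<i> * of_real x)))"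

text \<open>The partial sum is the convolution of \<phi> with the kernel over one period.
  Periodicity allows the period to be centred at u, and evenness of the kernel folds it onto
  [0, 1/2].\<close>

lemma fourier_partial_sum:
  assumes c: "continuous_on UNIV \<phi>" and per: "\<And>x. \<phi> (x + 1) = \<phi> x"
  shows "(\<Sum>l\<in>{-int L..int L}. fourier_coeff \<phi> l * exp (2 * of_int l * pi * \<i> * of_real u)) =
         integral {0..1/2} (\<lambda>x. (\<phi> (u + x) + \<phi> (u - x)) * dirichlet_kernel L x)"
proof -
  define h where "h = (\<lambda>x. \<phi> x * dirichlet_kernel L (x - u))"
  have hc: "continuous_on UNIV h" unfolding h_def by (intro continuous_intros c)
  have hp: "h (x + 1) = h x" for x
    using dirichlet_kernel_add_1[of L "x - u"] by (simp only: h_def per diff_add_eq)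
  have "(\<Sum>l\<in>{-int L..int L}. fourier_coeff \<phi> l * exp (2 * of_int l * pi * \<i> * of_real u)) =
     (\<Sum>l\<in>{-int L..int L}. integral {0..1} (\<lambda>x. \<phi> x * exp (2 * of_int l * pi * \<i> * of_real (u - x))))"
    unfolding fourier_coeff_def integral_mult_left [symmetric]
    by (intro sum.cong refl integral_cong) (simp add: algebra_simps exp_add exp_diff exp_minus field_simps)
  also have "\<dots> = integral {0..1} (\<lambda>x. \<Sum>l\<in>{-int L..int L}. \<phi> x * exp (2 * of_int l * pi * \<i> * of_real (u - x)))"
    by (intro integral_sum [symmetric] integrable_continuous_UNIV continuous_intros c) auto
  also have "\<dots> = integral {0..1} h"
    using dirichlet_kernel_minus[of L "u - x" for x] by (simp add: h_def sum_distrib_left [symmetric] dirichlet_kernel_def)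
  also have "\<dots> = integral {u - 1/2..u - 1/2 + 1} h"
    by (rule integral_periodic [symmetric]) (use hc hp in auto)
  also have "\<dots> = integral {u - 1/2..u} h + integral {u..u + 1/2} h"
    by (subst Henstock_Kurzweil_Integration.integral_combine)
       (auto intro: integrable_continuous_UNIV hc simp: algebra_simps)
  also have "integral {u..u + 1/2} h = integral {0..1/2} (\<lambda>x. h (x + u))"
    using integral_shift_real_ivl[of u u "u + 1/2" h] by simp
  also have "integral {u - 1/2..u} h = integral {-(1/2)..-0} (\<lambda>x. h (x + u))"
    using integral_shift_real_ivl[of "u - 1/2" u u h] by simp
  also have "\<dots> = integral {0..1/2} (\<lambda>x. h (- x + u))"
    using Henstock_Kurzweil_Integration.integral_reflect_real[of "1/2" 0 "\<lambda>x. h (- x + u)"] by simp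
  also have "integral {0..1/2} (\<lambda>x. h (- x + u)) + integral {0..1/2} (\<lambda>x. h (x + u)) =
       integral {0..1/2} (\<lambda>x. h (- x + u) + h (x + u))"
    unfolding h_def
    by (intro Henstock_Kurzweil_Integration.integral_add [symmetric] integrable_continuous_UNIV continuous_intros
        continuous_on_compose2[OF c]) auto
  also have "\<dots> = integral {0..1/2} (\<lambda>x. (\<phi> (u + x) + \<phi> (u - x)) * dirichlet_kernel L x)"
    by (simp add: h_def dirichlet_kernel_minus algebra_simps)
  finally show ?thesis .
qed

text \<open>This is \<open>fourier_partial_sum\<close> for the constant function 1 at u = 0, where
  only the coefficient l = 0 survives.\<close>

lemma integral_dirichlet_kernel: "integral {0..1/2} (dirichlet_kernel L) = 1/2"
proof -
  have coeff: "fourier_coeff (\<lambda>_. 1) l = (if l = 0 then 1 else 0)" for l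
  proof (cases "l = 0")
    case False
    define c where "c = - (2 * of_int l * pi * \<i>)"
    have c: "c \<noteq> 0" using False by (simp add: c_def)
    have "((\<lambda>x. exp (c * of_real x) / c) has_vector_derivative (exp (c * of_real x))) (at x within {0..1})" for x
      using has_vector_derivative_divide[OF has_vector_derivative_exp_of_real[of c x "{0..1}"], of c] c by simp
    then have "((\<lambda>x. exp (c * of_real x)) has_integral (exp (c * of_real 1) / c - exp (c * of_real 0) / c)) {0..1}"
      by (intro fundamental_theorem_of_calculus) auto
    moreover have "exp c = 1"
      using exp_integer_2pi[of "- of_int l"] by (simp add: c_def mult_ac)
    ultimately have "integral {0..1} (\<lambda>x. exp (c * of_real x)) = 0"
      by (simp add: integral_unique)
    then show ?thesis using False by (simp add: fourier_coeff_def c_def)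
  qed (simp add: fourier_coeff_def)
  have "(\<Sum>l\<in>{-int L..int L}. fourier_coeff (\<lambda>_. 1) l * exp (2 * of_int l * pi * \<i> * of_real 0)) = 1"
    by (simp add: coeff)
  then have "integral {0..1/2} (\<lambda>x. 2 * dirichlet_kernel L x) = 1"
    by (subst (asm) fourier_partial_sum) auto
  then show ?thesis by (simp add: field_simps)
qed

lemma holder_continuous_imp_continuous_on:
  assumes "holder_continuous \<alpha> \<phi>" "\<alpha> > 0"
  shows "continuous_on S \<phi>"
proof -
  obtain C where C: "\<And>x y. norm (\<phi> x - \<phi> y) \<le> C * \<bar>x - y\<bar> powr \<alpha>"
    using assms by (auto simp: holder_continuous_def)
  have "(\<phi> \<longlongrightarrow> \<phi> x) (at x within S)" for x
  proof -
    have "((\<lambda>y. y - x) \<longlongrightarrow> 0) (at x within S)"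
      using tendsto_diff[OF tendsto_ident_at[of x S] tendsto_const[of x]] by simp
    then have "((\<lambda>y. \<bar>y - x\<bar>) \<longlongrightarrow> 0) (at x within S)"
      by (rule tendsto_rabs_zero)
    then have "((\<lambda>y. \<bar>y - x\<bar> powr \<alpha>) \<longlongrightarrow> 0) (at x within S)"
      by (rule tendsto_zero_powrI[OF _ tendsto_const]) (use assms in auto)
    then have "((\<lambda>y. C * \<bar>y - x\<bar> powr \<alpha>) \<longlongrightarrow> 0) (at x within S)"
      by (rule tendsto_mult_right_zero)
    then have "((\<lambda>y. \<phi> y - \<phi> x) \<longlongrightarrow> 0) (at x within S)"
      by (rule Lim_null_comparison[rotated]) (use C in auto)
    then show ?thesis using LIM_zero_cancel by blast
  qed
  then show ?thesis by (simp add: continuous_on_def)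
qed

text \<open>Dini: the kernel is at most $2/x$ near 0, where the difference is $O(x^\alpha)$; away from 0 the
  telescoped kernel reduces the claim to the Riemann-Lebesgue lemma.\<close>
lemma fourier_series_holder:
  assumes H: "holder_continuous \<alpha> \<phi>" and \<alpha>: "\<alpha> > 0" and per: "\<And>x. \<phi> (x + 1) = \<phi> x"
  shows "(\<lambda>L. \<Sum>l\<in>{-int L..int L}. fourier_coeff \<phi> l * exp (2 * of_int l * pi * \<i> * of_real u)) \<longlonglongrightarrow> \<phi> u"
proof -
  obtain C where C: "\<And>x y. norm (\<phi> x - \<phi> y) \<le> C * \<bar>x - y\<bar> powr \<alpha>"
    using H by (auto simp: holder_continuous_def)
  have C0: "C \<ge> 0" using order_trans[OF norm_ge_zero C[of 0 1]] by simp
  have c: "continuous_on UNIV \<phi>" using holder_continuous_imp_continuous_on[OF H \<alpha>] .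
  \<comment> \<open>As the kernel has mass 1/2 on [0, 1/2], subtracting \<open>2 * \<phi> u\<close>
    inside the integral subtracts exactly \<open>\<phi> u\<close> from the partial sum.\<close>
  define \<psi> where "\<psi> = (\<lambda>x. \<phi> (u + x) + \<phi> (u - x) - 2 * \<phi> u)"
  have c\<psi>: "continuous_on S \<psi>" for S
    unfolding \<psi>_def by (intro continuous_intros continuous_on_compose2[OF c]) auto
  have \<psi>: "norm (\<psi> x) \<le> 2 * C * x powr \<alpha>" if "x \<ge> 0" for x
  proof -
    have "\<psi> x = (\<phi> (u + x) - \<phi> u) + (\<phi> (u - x) - \<phi> u)" by (simp add: \<psi>_def)
    then show ?thesis
      using norm_triangle_ineq[of "\<phi> (u + x) - \<phi> u" "\<phi> (u - x) - \<phi> u"] C[of "u + x" u] C[of "u - x" u] that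
      by simp
  qed
  define S where "S = (\<lambda>L. \<Sum>l\<in>{-int L..int L}. fourier_coeff \<phi> l * exp (2 * of_int l * pi * \<i> * of_real u))"
  have S: "S L - \<phi> u = integral {0..1/2} (\<lambda>x. \<psi> x * dirichlet_kernel L x)" for L
  proof -
    have "\<phi> u = integral {0..1/2} (\<lambda>x. 2 * \<phi> u * dirichlet_kernel L x)"
      by (simp add: integral_dirichlet_kernel)
    then have "S L - \<phi> u = integral {0..1/2} (\<lambda>x. (\<phi> (u + x) + \<phi> (u - x)) * dirichlet_kernel L x)
                 - integral {0..1/2} (\<lambda>x. 2 * \<phi> u * dirichlet_kernel L x)"
      unfolding S_def fourier_partial_sum[OF c per] by argo
    also have "\<dots> = integral {0..1/2} (\<lambda>x. \<psi> x * dirichlet_kernel L x)"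
      by (subst Henstock_Kurzweil_Integration.integral_diff [symmetric])
         (auto intro!: integrable_continuous_UNIV continuous_intros continuous_on_compose2[OF c]
               simp: \<psi>_def algebra_simps)
    finally show ?thesis .
  qed
  have "(\<lambda>L. S L - \<phi> u) \<longlonglongrightarrow> 0"
  proof (rule tendstoI)
    fix e :: real assume e: "e > 0"
    \<comment> \<open>The quantity 4 C d^\<alpha> / \<alpha> is the integral of 4 C x^(\<alpha> - 1)
      over [0, d], which will bound the part near 0 for all L at once; so d can be fixed before L
      grows.\<close>
    have "((\<lambda>d. 4 * C * (d powr \<alpha> / \<alpha>)) \<longlongrightarrow> 4 * C * (0 / \<alpha>)) (at_right 0)"
      using \<alpha> by (intro tendsto_mult tendsto_divide tendsto_const tendsto_zero_powrI[OF _ tendsto_const] tendsto_ident_at)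
         (auto simp: eventually_at_filter)
    then have "((\<lambda>d. 4 * C * (d powr \<alpha> / \<alpha>)) \<longlongrightarrow> 0) (at_right 0)" by simp
    then have "eventually (\<lambda>d. 4 * C * (d powr \<alpha> / \<alpha>) < e / 2) (at_right 0)"
      using e by (intro order_tendstoD(2)) auto
    moreover have "eventually (\<lambda>d::real. d < 1/2) (at_right 0)" "eventually (\<lambda>d::real. d > 0) (at_right 0)"
      by (auto intro!: eventually_at_rightI[of 0 "1/2"])
    ultimately have "eventually (\<lambda>d. 0 < d \<and> d < 1/2 \<and> 4 * C * (d powr \<alpha> / \<alpha>) < e / 2) (at_right 0)"
      by eventually_elim auto
    then obtain d where d: "0 < d" "d < 1/2" "4 * C * (d powr \<alpha> / \<alpha>) < e / 2"
      using eventually_happens'[OF trivial_limit_at_right_real] by blast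
    have near: "norm (integral {0..d} (\<lambda>x. \<psi> x * dirichlet_kernel L x)) < e / 2" for L
    proof -
      have "((\<lambda>x. 4 * C * x powr (\<alpha> - 1)) has_integral 4 * C * (d powr (\<alpha> - 1 + 1) / (\<alpha> - 1 + 1))) {0..d}"
        using \<alpha> d by (intro has_integral_mult_right has_integral_powr_from_0) auto
      then have I: "((\<lambda>x. 4 * C * x powr (\<alpha> - 1)) has_integral 4 * C * (d powr \<alpha> / \<alpha>)) {0..d}" by simp
      have "norm (\<psi> x * dirichlet_kernel L x) \<le> 4 * C * x powr (\<alpha> - 1)" if x: "x \<in> {0..d}" for x
      proof (cases "x = 0")
        case True
        \<comment> \<open>Here \<open>0 powr (\<alpha> - 1)\<close> is 0 by convention, so the bound
          demands \<psi> 0 = 0, which holds.\<close>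
        then show ?thesis using \<psi>[of 0] by simp
      next
        case False
        then have "x > 0" using x by auto
        define E where "E = exp (2 * pi * \<i> * of_real x) - 1"
        have E: "norm E \<ge> x" unfolding E_def using x d by (intro norm_exp_2pi_minus_1_ge) auto
        have "norm (E * dirichlet_kernel L x) \<le> 2"
          unfolding E_def dirichlet_kernel_telescope
          by (rule order_trans[OF norm_triangle_ineq4]) (simp del: of_real_mult of_real_add)
        then have "x * norm (dirichlet_kernel L x) \<le> 2"
          unfolding norm_mult using mult_right_mono[OF E norm_ge_zero[of "dirichlet_kernel L x"]] by linarith
        then have D: "norm (dirichlet_kernel L x) \<le> 2 / x" using \<open>x > 0\<close> by (simp add: field_simps)
        have "norm (\<psi> x * dirichlet_kernel L x) \<le> (2 * C * x powr \<alpha>) * (2 / x)"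
          unfolding norm_mult using D \<psi>[of x] \<open>x > 0\<close> C0 by (intro mult_mono) auto
        also have "\<dots> = 4 * C * x powr (\<alpha> - 1)" using \<open>x > 0\<close> by (simp add: powr_diff)
        finally show ?thesis .
      qed
      then have "norm (integral {0..d} (\<lambda>x. \<psi> x * dirichlet_kernel L x)) \<le> integral {0..d} (\<lambda>x. 4 * C * x powr (\<alpha> - 1))"
        using I by (intro integral_norm_bound_integral integrable_continuous_UNIV continuous_intros c\<psi>) blast+
      then show ?thesis unfolding integral_unique[OF I] using d(3) by linarith
    qed
    \<comment> \<open>On [d, 1/2] the denominator stays away from 0, so g is continuous and
      independent of L; only the two exponentials of the telescoped kernel depend on L.\<close>
    define g where "g = (\<lambda>x. \<psi> x / (exp (2 * pi * \<i> * of_real x) - 1))"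
    define W where "W = (\<lambda>t. integral {d..1/2} (\<lambda>x. g x * exp (\<i> * of_real (t * x))))"
    have nz: "exp (2 * pi * \<i> * of_real x) - 1 \<noteq> 0" if "x \<in> {d..1/2}" for x
    proof -
      have "0 < x" using that d by auto
      also have "x \<le> norm (exp (2 * pi * \<i> * of_real x) - 1)"
        using that d by (intro norm_exp_2pi_minus_1_ge) auto
      finally show ?thesis by auto
    qed
    have cg: "continuous_on {d..1/2} g"
      unfolding g_def using nz by (intro continuous_on_divide continuous_intros c\<psi>) auto
    have RL: "(W \<longlongrightarrow> 0) at_infinity" unfolding W_def by (rule riemann_lebesgue_continuous[OF cg])
    have lim_Suc: "filterlim (\<lambda>L. real L + 1) at_top sequentially"
      by (intro filterlim_at_top_mono[OF filterlim_real_sequentially]) auto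
    have lim: "filterlim (\<lambda>L. 2 * pi * (real L + 1)) at_top sequentially"
      by (rule filterlim_tendsto_pos_mult_at_top[OF tendsto_const _ lim_Suc]) simp
    have lim': "filterlim (\<lambda>L. 2 * pi * real L) at_top sequentially"
      by (rule filterlim_tendsto_pos_mult_at_top[OF tendsto_const _ filterlim_real_sequentially]) simp
    have lim1: "filterlim (\<lambda>L. 2 * pi * (real L + 1)) at_infinity sequentially"
      by (rule filterlim_at_top_imp_at_infinity[OF lim])
    have "filterlim (\<lambda>L. - (2 * pi * real L)) at_infinity sequentially"
      using filterlim_uminus_at_bot[of "\<lambda>L. - (2 * pi * real L)" sequentially] lim'
      by (intro filterlim_at_bot_imp_at_infinity) simp
    then have lim2: "filterlim (\<lambda>L. - 2 * pi * real L) at_infinity sequentially" by simp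
    have W0: "(\<lambda>L. W (2 * pi * (real L + 1)) - W (- 2 * pi * real L)) \<longlonglongrightarrow> 0"
      using tendsto_diff[OF filterlim_compose[OF RL lim1] filterlim_compose[OF RL lim2]] by simp
    have split: "S L - \<phi> u = integral {0..d} (\<lambda>x. \<psi> x * dirichlet_kernel L x) + (W (2 * pi * (real L + 1)) - W (- 2 * pi * real L))" for L
    proof -
      have i: "(\<lambda>x. g x * exp (\<i> * of_real (t * x))) integrable_on {d..1/2}" for t
        by (intro integrable_continuous_real continuous_intros cg)
      have eq: "\<psi> x * dirichlet_kernel L x =
              g x * exp (\<i> * of_real ((2 * pi * (real L + 1)) * x)) - g x * exp (\<i> * of_real ((- 2 * pi * real L) * x))"
        if "x \<in> {d..1/2}" for x
      proof -
        have "\<psi> x * dirichlet_kernel L x = g x * ((exp (2 * pi * \<i> * of_real x) - 1) * dirichlet_kernel L x)"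
          using nz[OF that] unfolding g_def by simp
        then show ?thesis unfolding dirichlet_kernel_telescope by (simp only: right_diff_distrib)
      qed
      have "S L - \<phi> u = integral {0..d} (\<lambda>x. \<psi> x * dirichlet_kernel L x) + integral {d..1/2} (\<lambda>x. \<psi> x * dirichlet_kernel L x)"
        unfolding S using d
        by (intro Henstock_Kurzweil_Integration.integral_combine [symmetric] integrable_continuous_UNIV continuous_intros c\<psi>) auto
      also have "integral {d..1/2} (\<lambda>x. \<psi> x * dirichlet_kernel L x) = integral {d..1/2} (\<lambda>x.
          g x * exp (\<i> * of_real ((2 * pi * (real L + 1)) * x)) - g x * exp (\<i> * of_real ((- 2 * pi * real L) * x)))"
        by (rule integral_cong) (rule eq)
      also have "\<dots> = W (2 * pi * (real L + 1)) - W (- 2 * pi * real L)"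
        unfolding W_def by (rule Henstock_Kurzweil_Integration.integral_diff[OF i i])
      finally show ?thesis .
    qed
    have "\<forall>\<^sub>F L in sequentially. norm (W (2 * pi * (real L + 1)) - W (- 2 * pi * real L)) < e / 2"
      using tendstoD[OF W0, of "e / 2"] e by (simp add: dist_norm)
    then show "\<forall>\<^sub>F L in sequentially. dist (S L - \<phi> u) 0 < e"
    proof eventually_elim
      case (elim L)
      have "norm (S L - \<phi> u) \<le> norm (integral {0..d} (\<lambda>x. \<psi> x * dirichlet_kernel L x)) + norm (W (2 * pi * (real L + 1)) - W (- 2 * pi * real L))"
        unfolding split by (rule norm_triangle_ineq)
      then show ?case using near[of L] elim unfolding dist_norm diff_0_right by linarith
    qed
  qed
  then show ?thesis unfolding S_def by (rule LIM_zero_cancel)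
qed

section \<open>Laplace transforms of periodic functions\<close>

text \<open>With x = q^u and L = log q the weight is x^(-z), so this is a truncated Mellin transform
  in x. On a compact interval it is entire in z when \<phi> is continuous; improper integrals appear
  only as limits in the endpoint.\<close>

definition laplace_segment :: "real \<Rightarrow> (real \<Rightarrow> complex) \<Rightarrow> real \<Rightarrow> real \<Rightarrow> complex \<Rightarrow> complex" where
  "laplace_segment L \<phi> a b z = integral {a..b} (\<lambda>u. \<phi> u * exp (- (z * of_real (L * u))))"

lemma laplace_segment_has_field_derivative:
  assumes c: "continuous_on {a..b} \<phi>"
  shows "(laplace_segment L \<phi> a b has_field_derivative
            laplace_segment L (\<lambda>u. - of_real (L * u) * \<phi> u) a b z) (at z)"
proof -
  have "((\<lambda>z. integral (cbox a b) (\<lambda>u. \<phi> u * exp (- (z * of_real (L * u))))) has_field_derivative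
          integral (cbox a b) (\<lambda>u. - of_real (L * u) * \<phi> u * exp (- (z * of_real (L * u))))) (at z within UNIV)"
  proof (rule leibniz_rule_field_derivative)
    fix z u
    show "((\<lambda>z. \<phi> u * exp (- (z * of_real (L * u)))) has_field_derivative
            - of_real (L * u) * \<phi> u * exp (- (z * of_real (L * u)))) (at z within UNIV)"
      by (rule derivative_eq_intros refl | simp)+
  next
    fix z
    show "(\<lambda>u. \<phi> u * exp (- (z * of_real (L * u)))) integrable_on cbox a b"
      using c by (intro integrable_continuous continuous_intros) auto
  next
    show "continuous_on (UNIV \<times> cbox a b) (\<lambda>(z, u). - of_real (L * u) * \<phi> u * exp (- (z * of_real (L * u))))"
      unfolding case_prod_unfold
      by (intro continuous_intros continuous_on_compose2[OF c]) auto
  qed auto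
  then show ?thesis by (simp add: laplace_segment_def [abs_def])
qed

lemma holomorphic_laplace_segment:
  "continuous_on {a..b} \<phi> \<Longrightarrow> laplace_segment L \<phi> a b holomorphic_on S"
  using laplace_segment_has_field_derivative holomorphic_on_def
  by (meson field_differentiable_at_within field_differentiable_def)

text \<open>This is how the powers of u, that is of log_q N, enter: each derivative in z brings down
  one factor -L u.\<close>

lemma higher_deriv_laplace_segment:
  assumes c: "continuous_on {a..b} \<phi>"
  shows "(deriv ^^ k) (laplace_segment L \<phi> a b) = laplace_segment L (\<lambda>u. (- of_real (L * u)) ^ k * \<phi> u) a b"
proof (induction k)
  case (Suc k)
  have "continuous_on {a..b} (\<lambda>u. (- of_real (L * u)) ^ k * \<phi> u)"
    by (intro continuous_intros c)
  from DERIV_imp_deriv[OF laplace_segment_has_field_derivative[OF this]] show ?case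
    by (simp add: Suc fun_eq_iff mult_ac)
qed simp

text \<open>The finite form of summing a geometric series over periods. It holds for every z and for
  non-integer U, with the last period [U, U + 1] as remainder.\<close>

lemma laplace_segment_periodic:
  assumes c: "continuous_on UNIV \<phi>" and per: "\<And>x. \<phi> (x + 1) = \<phi> x" and "U \<ge> 0"
  shows "(1 - exp (- (of_real L * z))) * laplace_segment L \<phi> 0 U z =
           laplace_segment L \<phi> 0 1 z - laplace_segment L \<phi> U (U + 1) z"
proof -
  define h where "h = (\<lambda>u. \<phi> u * exp (- (z * of_real (L * u))))"
  have hc: "continuous_on UNIV h" unfolding h_def by (intro continuous_intros c)
  have h: "h (u + 1) = exp (- (of_real L * z)) * h u" for u
    unfolding h_def per by (simp add: algebra_simps exp_add [symmetric] flip: exp_minus)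
  have "integral {0..U} h + integral {U..U+1} h = integral {0..U+1} h"
    using \<open>U \<ge> 0\<close> by (intro Henstock_Kurzweil_Integration.integral_combine integrable_continuous_UNIV hc) auto
  also have "\<dots> = integral {0..1} h + integral {1..U+1} h"
    using \<open>U \<ge> 0\<close> by (intro Henstock_Kurzweil_Integration.integral_combine [symmetric] integrable_continuous_UNIV hc) auto
  also have "integral {1..U+1} h = integral {0..U} (\<lambda>u. h (u + 1))"
    using integral_shift_real_ivl[of 1 1 "U + 1" h] by simp
  also have "\<dots> = exp (- (of_real L * z)) * integral {0..U} h"
    by (simp add: h)
  finally show ?thesis unfolding laplace_segment_def h_def [symmetric] by (simp add: algebra_simps)
qed

lemma norm_laplace_segment_le:
  assumes c: "continuous_on UNIV \<phi>" and B: "\<And>x. norm (\<phi> x) \<le> B" and L: "L > 0" and z: "Re z \<ge> 0"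
  shows "norm (laplace_segment L \<phi> U (U + 1) z) \<le> B * exp (- (Re z * (L * U)))"
proof -
  have B0: "B \<ge> 0" using order_trans[OF norm_ge_zero B] .
  have "norm (\<phi> u * exp (- (z * of_real (L * u)))) \<le> B * exp (- (Re z * (L * U)))" if "u \<in> {U..U+1}" for u
    using that L z B[of u] B0 by (auto simp: norm_mult intro!: mult_mono mult_left_mono)
  then have "norm (laplace_segment L \<phi> U (U + 1) z) \<le> B * exp (- (Re z * (L * U))) * (U + 1 - U)"
    unfolding laplace_segment_def
    by (intro integral_bound continuous_intros continuous_on_subset[OF c]) auto
  then show ?thesis by simp
qed

text \<open>For continuous 1-periodic \<phi>, L > 0 and Re z > 0 this is the full transform over [0,
  \<infinity>), summed over periods; the formula itself also makes sense further left and serves as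
  the continuation.\<close>

definition laplace_periodic :: "real \<Rightarrow> (real \<Rightarrow> complex) \<Rightarrow> complex \<Rightarrow> complex" where
  "laplace_periodic L \<phi> z = laplace_segment L \<phi> 0 1 z / (1 - exp (- (of_real L * z)))"

lemma periodic_continuous_bounded:
  fixes \<phi> :: "real \<Rightarrow> complex"
  assumes c: "continuous_on UNIV \<phi>" and per: "\<And>x. \<phi> (x + 1) = \<phi> x"
  shows "\<exists>B>0. \<forall>x. norm (\<phi> x) \<le> B"
proof -
  have "compact (\<phi> ` {0..1})"
    by (intro compact_continuous_image continuous_on_subset[OF c]) auto
  then have "bounded (\<phi> ` {0..1})" by (rule compact_imp_bounded)
  then obtain B where B: "B > 0" "\<And>x. x \<in> {0..1} \<Longrightarrow> norm (\<phi> x) \<le> B"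
    by (metis bounded_pos image_eqI)
  have "norm (\<phi> x) \<le> B" for x
  proof -
    have "\<phi> x = \<phi> (frac x)" by (rule periodic_frac[of \<phi>, OF per, symmetric])
    then show ?thesis using B(2)[of "frac x"] frac_lt_1[of x] by simp
  qed
  then show ?thesis using B(1) by blast
qed

text \<open>The remainder is a segment of size O(exp(-e L U)) over a denominator of modulus at least
  1 - exp(-L e). Uniformity in z is needed so that derivatives in z pass to the limit.\<close>

lemma uniform_limit_laplace_segment:
  assumes c: "continuous_on UNIV \<phi>" and per: "\<And>x. \<phi> (x + 1) = \<phi> x" and L: "L > 0" and e: "e > 0"
  shows "uniform_limit {z. Re z > e} (laplace_segment L \<phi> 0) (laplace_periodic L \<phi>) at_top"
proof -
  obtain B where B: "\<And>x. norm (\<phi> x) \<le> B" "B > 0"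
    using periodic_continuous_bounded[OF c per] by blast
  define K where "K = B / (1 - exp (- (L * e)))"
  have pos: "1 - exp (- (L * e)) > 0" using L e by simp
  have bound: "dist (laplace_segment L \<phi> 0 U z) (laplace_periodic L \<phi> z) \<le> K * exp (- (e * L * U))"
    if U: "U \<ge> 0" and z: "Re z > e" for U z
  proof -
    have "norm (exp (- (of_real L * z))) \<le> exp (- (L * e))" using L z by simp
    moreover have "norm (1 :: complex) - norm (exp (- (of_real L * z))) \<le> norm (1 - exp (- (of_real L * z)))"
      by (rule norm_triangle_ineq2)
    ultimately have ge: "norm (1 - exp (- (of_real L * z))) \<ge> 1 - exp (- (L * e))"
      unfolding norm_one by linarith
    then have nz: "1 - exp (- (of_real L * z)) \<noteq> 0" using pos by auto
    have "laplace_periodic L \<phi> z - laplace_segment L \<phi> 0 U z = laplace_segment L \<phi> U (U + 1) z / (1 - exp (- (of_real L * z)))"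
      using nz laplace_segment_periodic[OF c per U, of L z] by (simp add: laplace_periodic_def field_simps)
    then have "dist (laplace_segment L \<phi> 0 U z) (laplace_periodic L \<phi> z) = norm (laplace_segment L \<phi> U (U + 1) z) / norm (1 - exp (- (of_real L * z)))"
      by (metis dist_norm norm_divide norm_minus_commute)
    also have "\<dots> \<le> (B * exp (- (Re z * (L * U)))) / (1 - exp (- (L * e)))"
      using ge pos z e
      by (intro frac_le norm_laplace_segment_le[OF c B(1) L]) (use B(2) in auto)
    also have "\<dots> \<le> (B * exp (- (e * (L * U)))) / (1 - exp (- (L * e)))"
      using pos z L U B(2) by (intro divide_right_mono mult_left_mono) (auto intro!: mult_right_mono)
    also have "\<dots> = K * exp (- (e * L * U))" by (simp add: K_def mult_ac)
    finally show ?thesis .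
  qed
  have "((\<lambda>U. K * exp (- (e * L * U))) \<longlongrightarrow> 0) at_top"
  proof -
    have "filterlim (\<lambda>U. e * L * U) at_top at_top"
      using L e by (intro filterlim_tendsto_pos_mult_at_top[OF tendsto_const _ filterlim_ident]) auto
    then have "((\<lambda>U. exp (- (e * L * U))) \<longlongrightarrow> 0) at_top"
      by (intro filterlim_compose[OF exp_at_bot]) (simp add: filterlim_uminus_at_top)
    then show ?thesis by (rule tendsto_mult_right_zero)
  qed
  then have lim: "\<forall>\<^sub>F U in at_top. K * exp (- (e * L * U)) < d" if "d > 0" for d
    using that by (rule order_tendstoD(2))
  show ?thesis
  proof (rule uniform_limitI)
    fix d :: real assume "d > 0"
    show "\<forall>\<^sub>F U in at_top. \<forall>z\<in>{z. Re z > e}. dist (laplace_segment L \<phi> 0 U z) (laplace_periodic L \<phi> z) < d"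
      using lim[OF \<open>d > 0\<close>] eventually_ge_at_top[of 0]
    proof eventually_elim
      case (elim U)
      then show ?case using bound[of U] by (auto intro: le_less_trans)
    qed
  qed
qed

text \<open>The k-th derivative of the uniform limit produces (-L u)^k under the integral; the
  factor (-1/L)^k turns it into u^k.\<close>

lemma tendsto_laplace_segment_power:
  assumes c: "continuous_on UNIV \<phi>" and per: "\<And>x. \<phi> (x + 1) = \<phi> x" and L: "L > 0" and z: "Re z > 0"
  shows "((\<lambda>U. laplace_segment L (\<lambda>u. of_real u ^ k * \<phi> u) 0 U z) \<longlongrightarrow>
            (- 1 / of_real L) ^ k * (deriv ^^ k) (laplace_periodic L \<phi>) z) at_top"
proof -
  have cs: "continuous_on S \<phi>" for S by (rule continuous_on_subset[OF c]) auto
  have "((\<lambda>U. (deriv ^^ k) (laplace_segment L \<phi> 0 U) z) \<longlongrightarrow> (deriv ^^ k) (laplace_periodic L \<phi>) z) at_top"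
  proof (rule higher_deriv_complex_uniform_limit)
    \<comment> \<open>Halving Re z gives an open half-plane around z that keeps a positive distance
      from the imaginary axis.\<close>
    show "uniform_limit {w. Re w > Re z / 2} (laplace_segment L \<phi> 0) (laplace_periodic L \<phi>) at_top"
      using z by (intro uniform_limit_laplace_segment c per L) auto
    show "open {w. Re w > Re z / 2}" by (rule open_halfspace_Re_gt)
  qed (use z in \<open>auto intro!: always_eventually holomorphic_laplace_segment cs\<close>)
  then have "((\<lambda>U. (- 1 / of_real L) ^ k * (deriv ^^ k) (laplace_segment L \<phi> 0 U) z) \<longlongrightarrow>
      (- 1 / of_real L) ^ k * (deriv ^^ k) (laplace_periodic L \<phi>) z) at_top"
    by (intro tendsto_mult tendsto_const)
  moreover have "(- 1 / of_real L) ^ k * (deriv ^^ k) (laplace_segment L \<phi> 0 U) z =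
                  laplace_segment L (\<lambda>u. of_real u ^ k * \<phi> u) 0 U z" for U
  proof -
    have "(- 1 / of_real L) ^ k * (- of_real (L * u)) ^ k = (of_real u ^ k :: complex)" for u
      using L by (simp flip: power_mult_distrib)
    then show ?thesis
      unfolding higher_deriv_laplace_segment[OF cs] laplace_segment_def integral_mult_right [symmetric]
      by (simp add: mult.assoc [symmetric])
  qed
  ultimately show ?thesis by simp
qed

section \<open>Poles of the transform: the zeros of its denominator and the local expansions
  there\<close>

lemma exp_eq_1_iff_chi:
  assumes "q > 1"
  shows "exp (- (of_real (ln q) * z)) = 1 \<longleftrightarrow> z \<in> range (chi q)"
proof
  assume "exp (- (of_real (ln q) * z)) = 1"
  then have "exp (of_real (ln q) * z) = 1" by (simp add: exp_minus)
  then obtain n :: int where "of_real (ln q) * z = of_int (2 * n) * pi * \<i>"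
    unfolding exp_eq_1 by (auto simp: complex_eq_iff)
  then have "z = chi q n" using assms by (simp add: chi_def field_simps)
  then show "z \<in> range (chi q)" by blast
next
  assume "z \<in> range (chi q)"
  then obtain n where "z = chi q n" by blast
  then have "- (of_real (ln q) * z) = 2 * of_int (- n) * of_real pi * \<i>"
    using assms by (simp add: chi_def)
  then show "exp (- (of_real (ln q) * z)) = 1"
    using exp_integer_2pi[of "of_int (- n)"] by simp
qed

lemma closed_range_chi:
  assumes "q > 1"
  shows "closed (range (chi q))"
proof -
  have "range (chi q) = {z. exp (- (of_real (ln q) * z)) = 1}"
    using exp_eq_1_iff_chi[OF assms] by auto
  also have "closed \<dots>" by (intro closed_Collect_eq continuous_intros)
  finally show ?thesis .
qed

lemma holomorphic_laplace_periodic: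
  assumes "q > 1" "continuous_on UNIV \<phi>"
  shows "laplace_periodic (ln q) \<phi> holomorphic_on - range (chi q)"
proof -
  have "laplace_segment (ln q) \<phi> 0 1 holomorphic_on - range (chi q)"
    by (intro holomorphic_laplace_segment continuous_on_subset[OF assms(2)]) auto
  then show ?thesis unfolding laplace_periodic_def [abs_def]
    using exp_eq_1_iff_chi[OF assms(1)] by (intro holomorphic_intros) auto
qed

lemma laplace_segment_chi:
  assumes "q > 1"
  shows "laplace_segment (ln q) \<phi> 0 1 (chi q l) = fourier_coeff \<phi> l"
  using assms by (simp add: laplace_segment_def fourier_coeff_def chi_def mult_ac)

text \<open>The denominator is (z - p) H z with H p = log q, so it has a simple zero at p. The
  numerator divided by H is then holomorphic near p, and splitting off its value at p, which is the
  Fourier coefficient over log q, leaves a removable singularity.\<close>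

lemma laplace_periodic_simple_pole:
  assumes q: "q > 1" and c: "continuous_on UNIV \<phi>"
  obtains r e where "r > 0" "e holomorphic_on ball (chi q l) r"
    "\<And>z. z \<in> ball (chi q l) r - {chi q l} \<Longrightarrow>
       laplace_periodic (ln q) \<phi> z = fourier_coeff \<phi> l / of_real (ln q) / (z - chi q l) + e z"
proof -
  define p where "p = chi q l"
  define h :: "complex \<Rightarrow> complex" where "h = (\<lambda>z. 1 - exp (- (of_real (ln q) * z)))"
  have hp: "h p = 0" using exp_eq_1_iff_chi[OF q, of p] by (simp add: h_def p_def)
  have hol: "h holomorphic_on UNIV" unfolding h_def by (intro holomorphic_intros)
  have "(h has_field_derivative of_real (ln q) * exp (- (of_real (ln q) * p))) (at p)"
    unfolding h_def by (rule derivative_eq_intros refl | simp)+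
  then have dh: "deriv h p = of_real (ln q)"
    using hp by (simp add: DERIV_imp_deriv h_def)
  define H where "H = (\<lambda>z. if z = p then deriv h p else (h z - h p) / (z - p))"
  have Hhol: "H holomorphic_on UNIV" unfolding H_def by (intro pole_lemma hol) auto
  have Hp: "H p = of_real (ln q)" by (simp add: H_def dh)
  have hH: "h z = (z - p) * H z" for z using hp by (simp add: H_def)
  have "isCont H p"
    using holomorphic_on_imp_continuous_on[OF Hhol] by (simp add: continuous_on_eq_continuous_at)
  then obtain r where r: "r > 0" "\<And>z. dist p z < r \<Longrightarrow> H z \<noteq> 0"
    using continuous_at_avoid[of p H 0] Hp q by auto
  define g where "g = (\<lambda>z. laplace_segment (ln q) \<phi> 0 1 z / H z)"
  have "laplace_segment (ln q) \<phi> 0 1 holomorphic_on ball p r"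
    by (intro holomorphic_laplace_segment continuous_on_subset[OF c]) auto
  then have ghol: "g holomorphic_on ball p r"
    unfolding g_def using r(2) by (intro holomorphic_intros holomorphic_on_subset[OF Hhol]) auto
  define e where "e = (\<lambda>z. if z = p then deriv g p else (g z - g p) / (z - p))"
  have ehol: "e holomorphic_on ball p r" unfolding e_def using r(1) by (intro pole_lemma ghol) auto
  have "laplace_periodic (ln q) \<phi> z = fourier_coeff \<phi> l / of_real (ln q) / (z - p) + e z"
    if "z \<in> ball p r - {p}" for z
  proof -
    have gp: "g p = fourier_coeff \<phi> l / of_real (ln q)"
      by (simp only: g_def Hp) (simp add: laplace_segment_chi[OF q] p_def)
    have "laplace_periodic (ln q) \<phi> z = g z / (z - p)"
      using hH[of z] by (simp add: laplace_periodic_def g_def h_def mult.commute)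
    also have "\<dots> = g p / (z - p) + e z" using that by (simp add: e_def diff_divide_distrib)
    finally show ?thesis unfolding gp .
  qed
  then show ?thesis using that r(1) ehol unfolding p_def by blast
qed

lemma higher_deriv_simple_pole:
  fixes z p c :: complex
  assumes "z \<noteq> p"
  shows "(deriv ^^ k) (\<lambda>z. c / (z - p)) z = (-1) ^ k * fact k * c / (z - p) ^ Suc k"
  using assms
proof (induction k arbitrary: z)
  case (Suc k)
  have "(deriv ^^ Suc k) (\<lambda>z. c / (z - p)) z = deriv ((deriv ^^ k) (\<lambda>z. c / (z - p))) z" by simp
  also have "\<dots> = deriv (\<lambda>z. (-1) ^ k * fact k * c / (z - p) ^ Suc k) z"
  \<comment> \<open>The induction hypothesis holds only off p, so the derivative is compared on a
    punctured-free neighbourhood of z avoiding p.\<close>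
  proof (rule deriv_cong_ev)
    show "\<forall>\<^sub>F z in nhds z. (deriv ^^ k) (\<lambda>z. c / (z - p)) z = (-1) ^ k * fact k * c / (z - p) ^ Suc k"
      using t1_space_nhds[OF Suc.prems] by eventually_elim (rule Suc.IH)
  qed simp
  also have "\<dots> = (-1) ^ Suc k * fact (Suc k) * c / (z - p) ^ Suc (Suc k)"
  proof (rule DERIV_imp_deriv)
    have nz: "z - p \<noteq> 0" using Suc.prems by simp
    have "((\<lambda>z. (-1) ^ k * fact k * c / (z - p) ^ Suc k) has_field_derivative
        - ((-1) ^ k * fact k * c * (of_nat (Suc k) * (z - p) ^ k)) / ((z - p) ^ Suc k * (z - p) ^ Suc k)) (at z)"
    proof -
      have "((\<lambda>z. (z - p) ^ Suc k) has_field_derivative of_nat (Suc k) * (z - p) ^ k) (at z)"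
        by (rule DERIV_cong[OF DERIV_power[where n = "Suc k", OF DERIV_diff[OF DERIV_ident DERIV_const]]]) simp
      from DERIV_divide[OF DERIV_const this, of "(-1) ^ k * fact k * c"] show ?thesis
        using nz by (simp add: mult.assoc)
    qed
    also have "- ((-1) ^ k * fact k * c * (of_nat (Suc k) * (z - p) ^ k)) / ((z - p) ^ Suc k * (z - p) ^ Suc k) =
       (-1) ^ Suc k * fact (Suc k) * c / (z - p) ^ Suc (Suc k)"
    proof -
      define w where "w = z - p"
      then have "w \<noteq> 0" using nz by simp
      then show ?thesis unfolding w_def [symmetric] by (simp add: field_simps)
    qed
    finally show "((\<lambda>z. (-1) ^ k * fact k * c / (z - p) ^ Suc k) has_field_derivative
        (-1) ^ Suc k * fact (Suc k) * c / (z - p) ^ Suc (Suc k)) (at z)" .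
  qed
  finally show ?case .
qed simp

text \<open>Differentiating c / (z - p) gives one single power and differentiating e stays
  holomorphic; hence no lower-order polar terms appear at a pole of order k + 1.\<close>

lemma periodic_laplace_continuation:
  assumes q: "q > 1" and c: "continuous_on UNIV \<phi>" and per: "\<And>x. \<phi> (x + 1) = \<phi> x"
  obtains T where "T holomorphic_on - range (chi q)"
    "\<And>z. Re z > 0 \<Longrightarrow> ((\<lambda>U. laplace_segment (ln q) (\<lambda>u. of_real u ^ k * \<phi> u) 0 U z) \<longlongrightarrow> T z) at_top"
    "\<And>l. \<exists>r e. r > 0 \<and> e holomorphic_on ball (chi q l) r \<and> (\<forall>z \<in> ball (chi q l) r - {chi q l}.
        T z = fact k * fourier_coeff \<phi> l / of_real (ln q) ^ Suc k / (z - chi q l) ^ Suc k + e z)"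
proof
  let ?R = "laplace_periodic (ln q) \<phi>"
  define T where "T = (\<lambda>z. (- 1 / of_real (ln q)) ^ k * (deriv ^^ k) ?R z)"
  have L: "ln q > 0" using q by simp
  have hol: "?R holomorphic_on - range (chi q)" by (rule holomorphic_laplace_periodic[OF q c])
  have op: "open (- range (chi q))" using closed_range_chi[OF q] by auto
  show "T holomorphic_on - range (chi q)"
    unfolding T_def by (intro holomorphic_intros holomorphic_higher_deriv hol op)
  show "((\<lambda>U. laplace_segment (ln q) (\<lambda>u. of_real u ^ k * \<phi> u) 0 U z) \<longlongrightarrow> T z) at_top" if "Re z > 0" for z
    unfolding T_def by (rule tendsto_laplace_segment_power[OF c per L that])
  fix l
  define p where "p = chi q l"
  define a where "a = fourier_coeff \<phi> l / of_real (ln q)"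
  obtain r e where r: "r > 0" and e: "e holomorphic_on ball p r"
    and eq: "\<And>z. z \<in> ball p r - {p} \<Longrightarrow> ?R z = a / (z - p) + e z"
    unfolding p_def a_def using laplace_periodic_simple_pole[OF q c, of l] by blast
  define e' where "e' = (\<lambda>z. (- 1 / of_real (ln q)) ^ k * (deriv ^^ k) e z)"
  have "T z = fact k * fourier_coeff \<phi> l / of_real (ln q) ^ Suc k / (z - p) ^ Suc k + e' z"
    if z: "z \<in> ball p r - {p}" for z
  proof -
    have o: "open (ball p r - {p})" by auto
    have h1: "(\<lambda>z. a / (z - p)) holomorphic_on ball p r - {p}" by (intro holomorphic_intros) auto
    have h2: "e holomorphic_on ball p r - {p}" using e by (rule holomorphic_on_subset) auto
    have h12: "(\<lambda>z. a / (z - p) + e z) holomorphic_on ball p r - {p}"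
      by (intro holomorphic_intros h1 h2)
    have hR: "?R holomorphic_on ball p r - {p}"
      using h12 by (rule holomorphic_transform) (use eq in auto)
    have "(deriv ^^ k) ?R z = (deriv ^^ k) (\<lambda>z. a / (z - p) + e z) z"
      by (rule higher_deriv_transform_within_open[OF hR h12 o z eq])
    also have "\<dots> = (deriv ^^ k) (\<lambda>z. a / (z - p)) z + (deriv ^^ k) e z"
      by (rule higher_deriv_add[OF h1 h2 o z])
    also have "(deriv ^^ k) (\<lambda>z. a / (z - p)) z = (-1) ^ k * fact k * a / (z - p) ^ Suc k"
      using z by (intro higher_deriv_simple_pole) auto
    finally have "T z = (- 1 / of_real (ln q)) ^ k * ((-1) ^ k * fact k * a / (z - p) ^ Suc k) + e' z"
      by (simp add: T_def e'_def distrib_left)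
    \<comment> \<open>The sign (-1)^k from differentiating the pole cancels the one in
      (-1/L)^k.\<close>
    also have "(- 1 / of_real (ln q)) ^ k * ((-1) ^ k * fact k * a / (z - p) ^ Suc k) =
       ((- 1 / of_real (ln q)) * (-1)) ^ k * (fact k * a / (z - p) ^ Suc k)"
      by (simp only: power_mult_distrib) simp
    also have "\<dots> = fact k * fourier_coeff \<phi> l / of_real (ln q) ^ Suc k / (z - p) ^ Suc k"
      by (simp add: a_def power_one_over divide_simps)
    finally show ?thesis .
  qed
  moreover have "e' holomorphic_on ball p r"
    unfolding e'_def by (intro holomorphic_intros holomorphic_higher_deriv e) auto
  ultimately show "\<exists>r e. r > 0 \<and> e holomorphic_on ball (chi q l) r \<and> (\<forall>z \<in> ball (chi q l) r - {chi q l}.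
        T z = fact k * fourier_coeff \<phi> l / of_real (ln q) ^ Suc k / (z - chi q l) ^ Suc k + e z)"
    using r unfolding p_def by blast
qed

section \<open>Comparing the summatory function with its main term\<close>

lemma power_le_exp:
  assumes "\<epsilon> > (0::real)"
  shows "\<exists>C\<ge>0. \<forall>u\<ge>0. u ^ k \<le> C * exp (\<epsilon> * u)"
proof (intro exI conjI allI impI)
  \<comment> \<open>Raising d u <= exp(d u) to the k-th power needs k d <= \<epsilon>; the
    denominator k + 1 also covers k = 0.\<close>
  define d where "d = \<epsilon> / (real k + 1)"
  have d: "d > 0" "real k * d \<le> \<epsilon>" using assms by (auto simp: d_def field_simps)
  show "(1 / d) ^ k \<ge> 0" using d by simp
  fix u :: real assume u: "u \<ge> 0"
  have "d * u \<le> exp (d * u)" using exp_ge_add_one_self[of "d * u"] by linarith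
  then have "u \<le> 1 / d * exp (d * u)" using d by (simp add: field_simps)
  then have "u ^ k \<le> (1 / d * exp (d * u)) ^ k" using u by (rule power_mono)
  also have "\<dots> = (1 / d) ^ k * exp (real k * (d * u))"
    unfolding power_mult_distrib exp_of_nat_mult ..
  also have "\<dots> \<le> (1 / d) ^ k * exp (\<epsilon> * u)"
    using d u mult_right_mono[OF d(2) u] by (intro mult_left_mono) (auto simp: mult_ac)
  finally show "u ^ k \<le> (1 / d) ^ k * exp (\<epsilon> * u)" .
qed

text \<open>The gap \<beta> - Re \<kappa> pays for the polynomial factor, so powers of the logarithm
  need no separate bookkeeping.\<close>

lemma norm_exp_power_le:
  assumes L: "L > 0" and \<beta>: "\<beta> > Re \<kappa>"
  shows "\<exists>C\<ge>0. \<forall>u\<ge>0. norm (exp (\<kappa> * of_real (L * u)) * of_real u ^ k) \<le> C * exp (\<beta> * L * u)"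
proof -
  obtain C where C: "C \<ge> 0" "\<And>u. u \<ge> 0 \<Longrightarrow> u ^ k \<le> C * exp ((\<beta> - Re \<kappa>) * L * u)"
    using power_le_exp[of "(\<beta> - Re \<kappa>) * L" k] assms by auto
  have "norm (exp (\<kappa> * of_real (L * u)) * of_real u ^ k) \<le> C * exp (\<beta> * L * u)" if u: "u \<ge> 0" for u
  proof -
    have "norm (exp (\<kappa> * of_real (L * u)) * of_real u ^ k) = exp (Re \<kappa> * (L * u)) * u ^ k"
      using u by (simp add: norm_mult norm_power)
    also have "\<dots> \<le> exp (Re \<kappa> * (L * u)) * (C * exp ((\<beta> - Re \<kappa>) * L * u))"
      using C(2)[OF u] by (intro mult_left_mono) auto
    also have "\<dots> = C * exp (\<beta> * L * u)"
      by (simp add: algebra_simps flip: exp_add)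
    finally show ?thesis .
  qed
  then show ?thesis using C(1) by blast
qed

text \<open>The step bound $(2/L) e^{-Lu}$ dominates the distance from $u$ to the next point $\log_q n$.\<close>
lemma exp_power_holder_increment:
  assumes L: "L > 0" and \<beta>: "\<beta> > Re \<kappa>" and \<alpha>: "0 < \<alpha>" "\<alpha> \<le> 1"
    and H: "holder_continuous \<alpha> \<phi>" and per: "\<And>x. \<phi> (x + 1) = \<phi> x"
  shows "\<exists>C\<ge>0. \<forall>u w. 0 \<le> u \<longrightarrow> u \<le> w \<longrightarrow> w \<le> u + 2 / L * exp (- (L * u)) \<longrightarrow>
           norm (exp (\<kappa> * of_real (L * w)) * of_real w ^ k * \<phi> w - exp (\<kappa> * of_real (L * u)) * of_real u ^ k * \<phi> u)
             \<le> C * exp ((\<beta> - \<alpha>) * L * u)"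
proof -
  obtain Ch where Ch: "\<And>x y. norm (\<phi> x - \<phi> y) \<le> Ch * \<bar>x - y\<bar> powr \<alpha>"
    using H by (auto simp: holder_continuous_def)
  have Ch0: "Ch \<ge> 0" using order_trans[OF norm_ge_zero Ch[of 0 1]] by simp
  obtain B where B: "B > 0" "\<And>x. norm (\<phi> x) \<le> B"
    using periodic_continuous_bounded[OF holder_continuous_imp_continuous_on[OF H \<alpha>(1)] per] by blast
  obtain C0 where C0: "C0 \<ge> 0" "\<And>u. u \<ge> 0 \<Longrightarrow> norm (exp (\<kappa> * of_real (L * u)) * of_real u ^ k) \<le> C0 * exp (\<beta> * L * u)"
    using norm_exp_power_le[OF L \<beta>, of k] by blast
  obtain C1 where C1: "C1 \<ge> 0" "\<And>u. u \<ge> 0 \<Longrightarrow> norm (exp (\<kappa> * of_real (L * u)) * of_real u ^ (k - 1)) \<le> C1 * exp (\<beta> * L * u)"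
    using norm_exp_power_le[OF L \<beta>, of "k - 1"] by blast
  define g where "g = (\<lambda>z::complex. exp (\<kappa> * (of_real L * z)) * z ^ k)"
  \<comment> \<open>For k = 0 the truncated exponent k - 1 is harmless, since its term carries the
    factor k.\<close>
  define g' where "g' = (\<lambda>z::complex. \<kappa> * of_real L * (exp (\<kappa> * (of_real L * z)) * z ^ k) + of_nat k * (exp (\<kappa> * (of_real L * z)) * z ^ (k - 1)))"
  have dg: "(g has_field_derivative g' z) (at z within S)" for z S
    unfolding g_def g'_def by (rule derivative_eq_intros refl | simp)+
  \<comment> \<open>The bracket bounds the two terms of g' at v. The factor exp(2 |\<beta>|) is the
    price of moving from v back to u, as L (v - u) <= 2 and \<beta> may have either sign.\<close>
  define C2 where "C2 = (norm \<kappa> * L * C0 + k * C1) * exp (2 * \<bar>\<beta>\<bar>)"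
  have C2: "C2 \<ge> 0" using C0 C1 L by (simp add: C2_def)
  define C where "C = C2 * (2 / L) * B + C0 * (Ch * (2 / L) powr \<alpha>)"
  have "norm (g (of_real w) * \<phi> w - g (of_real u) * \<phi> u) \<le> C * exp ((\<beta> - \<alpha>) * L * u)"
    if u: "0 \<le> u" and uw: "u \<le> w" and w: "w \<le> u + 2 / L * exp (- (L * u))" for u w
  proof -
    have short: "L * (v - u) \<le> 2" if "v \<le> w" for v
    proof -
      have "exp (- (L * u)) \<le> 1" using L u by simp
      then have "2 / L * exp (- (L * u)) \<le> 2 / L" using L by (simp add: field_simps)
      then have "v - u \<le> 2 / L" using that w by linarith
      then show ?thesis using L by (simp add: field_simps)
    qed
    have g'_le: "norm (g' (of_real v)) \<le> C2 * exp (\<beta> * L * u)" if v: "u \<le> v" "v \<le> w" for v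
    proof -
      have v0: "v \<ge> 0" using u v by simp
      have "norm (g' (of_real v)) \<le> norm \<kappa> * L * norm (exp (\<kappa> * of_real (L * v)) * of_real v ^ k) +
               k * norm (exp (\<kappa> * of_real (L * v)) * of_real v ^ (k - 1))"
        unfolding g'_def by (rule order_trans[OF norm_triangle_ineq]) (use L in \<open>simp add: norm_mult\<close>)
      also have "\<dots> \<le> norm \<kappa> * L * (C0 * exp (\<beta> * L * v)) + k * (C1 * exp (\<beta> * L * v))"
        using L by (intro add_mono mult_left_mono C0(2) C1(2) v0) auto
      also have "\<dots> = (norm \<kappa> * L * C0 + k * C1) * exp (\<beta> * L * v)" by (simp add: algebra_simps)
      also have "\<dots> \<le> (norm \<kappa> * L * C0 + k * C1) * (exp (2 * \<bar>\<beta>\<bar>) * exp (\<beta> * L * u))"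
      proof (intro mult_left_mono)
        have "\<beta> * (L * (v - u)) \<le> \<bar>\<beta>\<bar> * (L * (v - u))" using L v by (intro mult_right_mono) auto
        also have "\<dots> \<le> \<bar>\<beta>\<bar> * 2" using short[OF v(2)] by (intro mult_left_mono) auto
        finally have "\<beta> * L * v \<le> 2 * \<bar>\<beta>\<bar> + \<beta> * L * u" by (simp add: algebra_simps)
        then show "exp (\<beta> * L * v) \<le> exp (2 * \<bar>\<beta>\<bar>) * exp (\<beta> * L * u)" by (simp flip: exp_add)
      qed (use C0 C1 L in auto)
      finally show ?thesis by (simp add: C2_def mult_ac)
    qed
    have "norm (g (of_real w) - g (of_real u)) \<le> C2 * exp (\<beta> * L * u) * norm (complex_of_real w - of_real u)"
    proof (rule field_differentiable_bound[OF convex_closed_segment dg])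
      fix z assume "z \<in> closed_segment (complex_of_real u) (of_real w)"
      then show "norm (g' z) \<le> C2 * exp (\<beta> * L * u)"
        using uw g'_le by (auto simp: closed_segment_of_real closed_segment_eq_real_ivl)
    qed auto
    also have "norm (complex_of_real w - of_real u) = w - u"
      using uw by (simp flip: of_real_diff)
    also have "C2 * exp (\<beta> * L * u) * (w - u) \<le> C2 * exp (\<beta> * L * u) * (2 / L * exp (- (L * u)))"
      using w C2 by (intro mult_left_mono) auto
    also have "\<dots> = C2 * (2 / L) * exp ((\<beta> - 1) * L * u)"
      by (simp add: algebra_simps flip: exp_add)
    \<comment> \<open>The smooth factor gains a full exp(-L u); \<alpha> <= 1 weakens this to the
      Hoelder rate of \<phi>.\<close>
    also have "\<dots> \<le> C2 * (2 / L) * exp ((\<beta> - \<alpha>) * L * u)"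
      using C2 L u \<alpha> by (intro mult_left_mono) (auto intro!: mult_right_mono)
    finally have 1: "norm (g (of_real w) - g (of_real u)) * norm (\<phi> w) \<le> C2 * (2 / L) * exp ((\<beta> - \<alpha>) * L * u) * B"
      using B C2 L by (intro mult_mono) auto
    have "norm (\<phi> w - \<phi> u) \<le> Ch * \<bar>w - u\<bar> powr \<alpha>" by (rule Ch)
    also have "\<dots> \<le> Ch * (2 / L * exp (- (L * u))) powr \<alpha>"
      using uw w Ch0 \<alpha> by (intro mult_left_mono powr_mono2) auto
    also have "\<dots> = Ch * (2 / L) powr \<alpha> * exp (- (\<alpha> * L * u))"
    proof -
      have "(2 / L * exp (- (L * u))) powr \<alpha> = (2 / L) powr \<alpha> * exp (- (L * u)) powr \<alpha>"
        using L by (intro powr_mult)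
      then show ?thesis by (simp add: exp_powr_real mult_ac)
    qed
    finally have "norm (g (of_real u)) * norm (\<phi> w - \<phi> u) \<le> (C0 * exp (\<beta> * L * u)) * (Ch * (2 / L) powr \<alpha> * exp (- (\<alpha> * L * u)))"
      using C0(1) C0(2)[OF u] by (intro mult_mono) (auto simp: g_def)
    also have "\<dots> = C0 * (Ch * (2 / L) powr \<alpha>) * exp ((\<beta> - \<alpha>) * L * u)"
      by (simp add: algebra_simps flip: exp_add)
    finally have 2: "norm (g (of_real u)) * norm (\<phi> w - \<phi> u) \<le> C0 * (Ch * (2 / L) powr \<alpha>) * exp ((\<beta> - \<alpha>) * L * u)" .
    have "g (of_real w) * \<phi> w - g (of_real u) * \<phi> u = (g (of_real w) - g (of_real u)) * \<phi> w + g (of_real u) * (\<phi> w - \<phi> u)"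
      by (simp add: algebra_simps)
    then have "norm (g (of_real w) * \<phi> w - g (of_real u) * \<phi> u) \<le> norm (g (of_real w) - g (of_real u)) * norm (\<phi> w) + norm (g (of_real u)) * norm (\<phi> w - \<phi> u)"
      by (metis norm_mult norm_triangle_ineq)
    also have "\<dots> \<le> C * exp ((\<beta> - \<alpha>) * L * u)" using 1 2 by (simp add: C_def algebra_simps)
    finally show ?thesis .
  qed
  moreover have "C \<ge> 0" using C2 L B C0 Ch0 by (simp add: C_def)
  ultimately show ?thesis by (auto simp: g_def)
qed

lemma norm_sum_le_uniform:
  fixes g :: "nat \<Rightarrow> 'a \<Rightarrow> complex"
  assumes "\<And>k. k < m \<Longrightarrow> \<exists>C\<ge>0. \<forall>x\<in>X. norm (g k x) \<le> C * b x"
  shows "\<exists>C\<ge>0. \<forall>x\<in>X. norm (\<Sum>k<m. g k x) \<le> C * b x"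
proof -
  obtain C where C: "\<And>k. k < m \<Longrightarrow> C k \<ge> 0 \<and> (\<forall>x\<in>X. norm (g k x) \<le> C k * b x)"
    using assms by metis
  have "norm (\<Sum>k<m. g k x) \<le> (\<Sum>k<m. C k) * b x" if "x \<in> X" for x
    unfolding sum_distrib_right using C that by (intro sum_norm_le) auto
  then show ?thesis using C by (intro exI[of _ "\<Sum>k<m. C k"]) (auto intro!: sum_nonneg)
qed

text \<open>The finitely many N below the threshold are absorbed into the constant through their
  ratios. N = 0 is excluded because \<open>0 powr a\<close> is 0.\<close>

lemma bigo_powr_nat_uniform:
  fixes r :: "nat \<Rightarrow> complex"
  assumes "(\<lambda>N. norm (r N)) \<in> O(\<lambda>N. real N powr a)"
  shows "\<exists>C\<ge>0. \<forall>N\<ge>1. norm (r N) \<le> C * real N powr a"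
proof -
  obtain c where c: "c > 0" "\<forall>\<^sub>F N in sequentially. norm (r N) \<le> c * real N powr a"
    using landau_o.bigE[OF assms] by (auto simp: norm_powr_real_powr)
  then obtain M where M: "\<And>N. N \<ge> M \<Longrightarrow> norm (r N) \<le> c * real N powr a"
    by (auto simp: eventually_sequentially)
  define C where "C = c + (\<Sum>N\<in>{1..<M}. norm (r N) / real N powr a)"
  have S0: "(\<Sum>N\<in>{1..<M}. norm (r N) / real N powr a) \<ge> 0" by (intro sum_nonneg) auto
  have "norm (r N) \<le> C * real N powr a" if N: "N \<ge> 1" for N
  proof (cases "N \<ge> M")
    case True
    then have "norm (r N) \<le> c * real N powr a" by (rule M)
    also have "\<dots> \<le> C * real N powr a" using S0 by (intro mult_right_mono) (auto simp: C_def)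
    finally show ?thesis .
  next
    case False
    have "norm (r N) / real N powr a \<le> (\<Sum>N\<in>{1..<M}. norm (r N) / real N powr a)"
      using False N by (intro member_le_sum) auto
    also have "\<dots> \<le> C" using c by (simp add: C_def)
    finally show ?thesis using N by (simp add: field_simps)
  qed
  then show ?thesis using c S0 by (intro exI[of _ C]) (auto simp: C_def)
qed

section \<open>Abel summation and the transform of the remainder\<close>

lemma laplace_segment_const:
  assumes "a \<le> b"
  shows "s * of_real L * laplace_segment L (\<lambda>_. c) a b s =
           c * (exp (- (s * of_real (L * a))) - exp (- (s * of_real (L * b))))"
proof -
  have "((\<lambda>u. s * of_real L * (c * exp (- (s * of_real (L * u))))) has_integral
          (- c * exp (- (s * of_real L) * of_real b)) - (- c * exp (- (s * of_real L) * of_real a))) {a..b}"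
  proof (rule fundamental_theorem_of_calculus[OF assms])
    fix x
    have "((\<lambda>x. - c * exp (- (s * of_real L) * of_real x)) has_vector_derivative
            - c * (- (s * of_real L) * exp (- (s * of_real L) * of_real x))) (at x within {a..b})"
      by (intro has_vector_derivative_mult_right has_vector_derivative_exp_of_real)
    then show "((\<lambda>x. - c * exp (- (s * of_real L) * of_real x)) has_vector_derivative
            s * of_real L * (c * exp (- (s * of_real (L * x))))) (at x within {a..b})"
      by (simp add: mult_ac)
  qed
  from integral_unique[OF this] show ?thesis
    by (simp add: laplace_segment_def algebra_simps)
qed

text \<open>For x in (n + 1, n + 2] the sum over integers below x is F (n + 2), so each segment
  carries one constant value of the step function. Subtracting A segment by segment and adding it
  back over the whole range is exact for every s; it separates a series that will converge for Re s
  > \<open>\<kappa>0\<close> from the transform of the main term.\<close>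

lemma abel_summation_laplace:
  fixes f :: "nat \<Rightarrow> complex"
  assumes q: "q > 1" and A: "continuous_on UNIV A"
  defines "F \<equiv> \<lambda>N. \<Sum>n\<in>{1..<N}. f n"
  shows "(\<Sum>n<N. f (Suc n) / of_nat (Suc n) powr s) =
     F (Suc N) * exp (- (s * of_real (ln (real (Suc N))))) +
     s * of_real (ln q) * ((\<Sum>n<N. laplace_segment (ln q) (\<lambda>u. F (n + 2) - A u) (log q (real (Suc n))) (log q (real (n + 2))) s)
        + laplace_segment (ln q) A 0 (log q (real (Suc N))) s)"
proof (induction N)
  case 0
  then show ?case by (simp add: F_def laplace_segment_def)
next
  case (Suc N)
  define a where "a = (\<lambda>n. log q (real n))"
  define L where "L = ln q"
  define E where "E = (\<lambda>n. exp (- (s * of_real (ln (real n)))))"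
  define h where "h = (\<lambda>n. laplace_segment L (\<lambda>u. F (n + 2) - A u) (a (Suc n)) (a (n + 2)) s)"
  have L: "L > 0" using q by (simp add: L_def)
  have La: "L * a n = ln (real n)" for n using L by (simp add: a_def L_def log_def)
  have a0: "0 \<le> a (Suc n)" "a (Suc n) \<le> a (n + 2)" for n
    using q by (auto simp: a_def)
  have cont: "continuous_on S (\<lambda>u. A u * exp (- (s * of_real (L * u))))"
      "continuous_on S (\<lambda>u. c * exp (- (s * of_real (L * u))))" for S c
    by (intro continuous_intros continuous_on_subset[OF A]; simp)+
  have hN: "h N = laplace_segment L (\<lambda>_. F (N + 2)) (a (Suc N)) (a (N + 2)) s - laplace_segment L A (a (Suc N)) (a (N + 2)) s"
    unfolding h_def laplace_segment_def left_diff_distrib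
    by (intro Henstock_Kurzweil_Integration.integral_diff integrable_continuous_real cont)
  have comb: "laplace_segment L A 0 (a (Suc N)) s + laplace_segment L A (a (Suc N)) (a (N + 2)) s = laplace_segment L A 0 (a (N + 2)) s"
    unfolding laplace_segment_def using a0
    by (intro Henstock_Kurzweil_Integration.integral_combine integrable_continuous_real cont) auto
  have const: "s * of_real L * laplace_segment L (\<lambda>_. F (N + 2)) (a (Suc N)) (a (N + 2)) s = F (N + 2) * (E (Suc N) - E (N + 2))"
    unfolding laplace_segment_const[OF a0(2)] La E_def ..
  have F: "F (N + 2) = F (Suc N) + f (Suc N)" by (simp add: F_def)
  have "(\<Sum>n<Suc N. f (Suc n) / of_nat (Suc n) powr s) =
      F (Suc N) * E (Suc N) + s * of_real L * ((\<Sum>n<N. h n) + laplace_segment L A 0 (a (Suc N)) s) + f (Suc N) * E (Suc N)"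
    using Suc by (simp add: E_def h_def a_def L_def powr_def exp_minus field_simps del: of_nat_Suc)
  also have "\<dots> = F (N + 2) * E (N + 2) + s * of_real L * laplace_segment L (\<lambda>_. F (N + 2)) (a (Suc N)) (a (N + 2)) s
      + s * of_real L * ((\<Sum>n<N. h n) + laplace_segment L A 0 (a (Suc N)) s)"
    unfolding const unfolding F by (simp add: algebra_simps)
  also have "\<dots> = F (N + 2) * E (N + 2) + s * of_real L * ((\<Sum>n<Suc N. h n) + laplace_segment L A 0 (a (N + 2)) s)"
    unfolding comb [symmetric] by (simp add: hN algebra_simps)
  finally show ?case by (simp add: E_def h_def a_def L_def)
qed

text \<open>All four bounds follow from log(1 + 1/(n + 1)) <= 1/(n + 1). The factor 2 in the first
  comes from n + 2 <= 2 (n + 1), which converts 1/(n + 1) into exp(-L u).\<close>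

lemma log_Suc_diff_le:
  assumes q: "q > 1" and u: "log q (real (Suc n)) \<le> u" "u \<le> log q (real (n + 2))"
  shows "log q (real (n + 2)) \<le> u + 2 / ln q * exp (- (ln q * u))"
    and "log q (real (n + 2)) - log q (real (Suc n)) \<le> 1 / ln q / real (Suc n)"
    and "ln (real (n + 2)) \<le> ln q * u + 1"
    and "ln (real (Suc n)) \<le> ln q * u"
proof -
  have L: "ln q > 0" using q by simp
  have Lu: "ln (real (Suc n)) \<le> ln q * u" "ln q * u \<le> ln (real (n + 2))"
    using u L by (auto simp: log_def field_simps)
  then show "ln (real (Suc n)) \<le> ln q * u" by simp
  have "real (n + 2) / real (Suc n) = 1 + 1 / real (Suc n)" by (simp add: field_simps)
  then have "ln (real (n + 2)) - ln (real (Suc n)) = ln (1 + 1 / real (Suc n))"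
    by (subst ln_divide_pos [symmetric]) auto
  also have "\<dots> \<le> 1 / real (Suc n)" by (rule ln_add_one_self_le_self) simp
  finally have d: "ln (real (n + 2)) - ln (real (Suc n)) \<le> 1 / real (Suc n)" .
  also have "\<dots> \<le> 1" by simp
  finally show "ln (real (n + 2)) \<le> ln q * u + 1" using Lu(1) by linarith
  have "log q (real (n + 2)) - log q (real (Suc n)) = (ln (real (n + 2)) - ln (real (Suc n))) / ln q"
    by (simp add: log_def diff_divide_distrib)
  also have "\<dots> \<le> 1 / real (Suc n) / ln q" using d L by (intro divide_right_mono) auto
  finally show gap: "log q (real (n + 2)) - log q (real (Suc n)) \<le> 1 / ln q / real (Suc n)" by (simp add: mult.commute)
  have "exp (ln q * u) \<le> real (n + 2)" using Lu(2) by (metis exp_le_cancel_iff exp_ln of_nat_0_less_iff zero_less_Suc add_2_eq_Suc')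
  also have "\<dots> \<le> 2 * real (Suc n)" by simp
  finally have "1 / real (Suc n) \<le> 2 * exp (- (ln q * u))"
    by (simp add: exp_minus field_simps)
  then have "1 / real (Suc n) / ln q \<le> 2 * exp (- (ln q * u)) / ln q" using L by (intro divide_right_mono) auto
  then show "log q (real (n + 2)) \<le> u + 2 / ln q * exp (- (ln q * u))"
    using gap u(1) by (simp add: mult.commute)
qed

text \<open>For Re s >= \<open>\<kappa>0\<close> + e the integrand is O((n + 1)^(-e)) and the
  interval has length O(1/(n + 1)), so the terms are dominated by (n + 1)^(-1-e), locally uniformly
  in s.\<close>

lemma holomorphic_laplace_segment_series:
  assumes q: "q > 1" and B: "\<And>n. continuous_on UNIV (B n)" and C: "C \<ge> 0"
    and le: "\<And>n u. log q (real (Suc n)) \<le> u \<Longrightarrow> u \<le> log q (real (n + 2)) \<Longrightarrow> norm (B n u) \<le> C * exp (\<kappa>0 * ln q * u)"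
  obtains H where "H holomorphic_on {s. Re s > \<kappa>0}"
    "\<And>s. Re s > \<kappa>0 \<Longrightarrow> (\<lambda>n. laplace_segment (ln q) (B n) (log q (real (Suc n))) (log q (real (n + 2))) s) sums H s"
proof -
  define h where "h = (\<lambda>n. laplace_segment (ln q) (B n) (log q (real (Suc n))) (log q (real (n + 2))))"
  have L: "ln q > 0" using q by simp
  have hol: "h n holomorphic_on S" for n S
    unfolding h_def by (intro holomorphic_laplace_segment continuous_on_subset[OF B]) auto
  have bound: "norm (h n s) \<le> C / ln q * real (Suc n) powr (- 1 - e)" if e: "e > 0" "Re s \<ge> \<kappa>0 + e" for n s e
  proof -
    have ord: "log q (real (Suc n)) \<le> log q (real (n + 2))" using q by simp
    have "norm (B n u * exp (- (s * of_real (ln q * u)))) \<le> C * real (Suc n) powr (- e)"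
      if u: "u \<in> {log q (real (Suc n))..log q (real (n + 2))}" for u
    proof -
      have u1: "ln (real (Suc n)) \<le> ln q * u" using log_Suc_diff_le(4)[OF q, of n u] u by auto
      have u0: "0 \<le> ln q * u" by (rule order_trans[OF _ u1]) simp
      have "norm (B n u * exp (- (s * of_real (ln q * u)))) \<le> C * exp (\<kappa>0 * ln q * u) * exp (- (Re s * (ln q * u)))"
        unfolding norm_mult using le[of n u] u by (intro mult_mono) (auto simp: C)
      also have "\<dots> = C * exp (- ((Re s - \<kappa>0) * (ln q * u)))"
        by (simp add: algebra_simps flip: exp_add)
      also have "\<dots> \<le> C * exp (- (e * ln (real (Suc n))))"
        using e u0 u1 C by (intro mult_left_mono) (auto intro!: mult_mono)
      also have "\<dots> = C * real (Suc n) powr (- e)" by (simp add: powr_def)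
      finally show ?thesis .
    qed
    then have "norm (h n s) \<le> C * real (Suc n) powr (- e) * (log q (real (n + 2)) - log q (real (Suc n)))"
      unfolding h_def laplace_segment_def
      by (intro integral_bound ord continuous_intros continuous_on_subset[OF B]) auto
    also have "\<dots> \<le> C * real (Suc n) powr (- e) * (1 / ln q / real (Suc n))"
      using C log_Suc_diff_le(2)[OF q order_refl ord] by (intro mult_left_mono) auto
    also have "\<dots> = C / ln q * real (Suc n) powr (- 1 - e)"
      by (simp add: powr_diff powr_minus field_simps)
    finally show ?thesis .
  qed
  obtain H where H: "\<forall>s\<in>{s. Re s > \<kappa>0}. (\<lambda>n. h n s) sums H s \<and> H field_differentiable (at s)"
  proof (rule series_differentiable_comparison_complex[of "{s. Re s > \<kappa>0}" h])
    show "open {s. Re s > \<kappa>0}" by (rule open_halfspace_Re_gt)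
    show "h n field_differentiable at s" for n s
      using hol[of n UNIV] by (simp add: holomorphic_on_def)
  next
    fix s assume "s \<in> {s. Re s > \<kappa>0}"
    then have s: "Re s > \<kappa>0" by simp
    \<comment> \<open>Half the distance to the boundary line: every y within e of s still satisfies
      Re y >= \<open>\<kappa>0\<close> + e.\<close>
    define e where "e = (Re s - \<kappa>0) / 2"
    have e: "e > 0" using s by (simp add: e_def)
    have "summable (\<lambda>n. real n powr (- 1 - e))" using e by (simp add: summable_real_powr_iff)
    then have "summable (\<lambda>n. real (Suc n) powr (- 1 - e))" by (subst summable_Suc_iff)
    then have sum: "summable (\<lambda>n. complex_of_real (C / ln q * real (Suc n) powr (- 1 - e)))"
      by (intro summable_of_real summable_mult)
    show "\<exists>d M. 0 < d \<and> summable M \<and> range M \<subseteq> \<real>\<^sub>\<ge>\<^sub>0 \<and>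
            (\<forall>\<^sub>F n in sequentially. \<forall>y\<in>ball s d \<inter> {s. Re s > \<kappa>0}. norm (h n y) \<le> norm (M n :: complex))"
    proof (intro exI conjI)
      show "0 < e" by (rule e)
      show "summable (\<lambda>n. complex_of_real (C / ln q * real (Suc n) powr (- 1 - e)))" by (rule sum)
      show "range (\<lambda>n. complex_of_real (C / ln q * real (Suc n) powr (- 1 - e))) \<subseteq> \<real>\<^sub>\<ge>\<^sub>0"
        using C L by (auto simp: complex_nonneg_Reals_iff)
      show "\<forall>\<^sub>F n in sequentially. \<forall>y\<in>ball s e \<inter> {s. Re s > \<kappa>0}.
              norm (h n y) \<le> norm (complex_of_real (C / ln q * real (Suc n) powr (- 1 - e)))"
      proof (intro always_eventually allI ballI)
        fix n y assume "y \<in> ball s e \<inter> {s. Re s > \<kappa>0}"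
        then have "norm (s - y) < e" by (simp add: dist_norm)
        then have "\<bar>Re (s - y)\<bar> < e" by (rule le_less_trans[OF abs_Re_le_cmod])
        then have "Re y \<ge> \<kappa>0 + e" by (simp add: e_def field_simps abs_if split: if_splits)
        then have "norm (h n y) \<le> C / ln q * real (Suc n) powr (- 1 - e)" by (rule bound[OF e])
        then show "norm (h n y) \<le> norm (complex_of_real (C / ln q * real (Suc n) powr (- 1 - e)))"
          unfolding norm_of_real by linarith
      qed
    qed
  qed
  have "H holomorphic_on {s. Re s > \<kappa>0}"
    using H by (auto simp: holomorphic_on_def intro: field_differentiable_at_within)
  then show ?thesis using that H unfolding h_def by blast
qed

text \<open>The remainder yields H and the main term yields the \<open>T k\<close>, shifted by
  \<kappa>. Only the limits of the transforms for Re z > 0 enter, so the identity is asserted just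
  where the Dirichlet series converges; extending it is left to the identity theorem.\<close>

lemma dirichlet_series_continuation:
  fixes f :: "nat \<Rightarrow> complex"
  assumes q: "q > 1" and \<kappa>: "\<kappa>0 < Re \<kappa>" and \<alpha>: "Re \<kappa> - \<kappa>0 < \<alpha>" "\<alpha> \<le> 1"
    and per: "\<And>k u. k < m \<Longrightarrow> \<Phi> k (u + 1) = \<Phi> k u"
    and holder: "\<And>k. k < m \<Longrightarrow> holder_continuous \<alpha> (\<Phi> k)"
    and asymp: "(\<lambda>N::nat. norm ((\<Sum>n\<in>{1..<N}. f n)
                   - (\<Sum>k<m. of_nat N powr \<kappa> * of_real (log q (real N)) ^ k * \<Phi> k (frac (log q (real N))))))
               \<in> O(\<lambda>N. real N powr \<kappa>0)"
    and G: "\<And>s. Re s > \<sigma>a \<Longrightarrow> (\<lambda>n. f (Suc n) / of_nat (Suc n) powr s) sums G s" and \<sigma>a: "Re \<kappa> \<le> \<sigma>a"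
    and T: "\<And>k z. k < m \<Longrightarrow> Re z > 0 \<Longrightarrow>
              ((\<lambda>U. laplace_segment (ln q) (\<lambda>u. of_real u ^ k * \<Phi> k u) 0 U z) \<longlongrightarrow> T k z) at_top"
  shows "\<exists>H. H holomorphic_on {s. Re s > \<kappa>0} \<and>
          (\<forall>s. Re s > \<sigma>a \<longrightarrow> G s = s * of_real (ln q) * (H s + (\<Sum>k<m. T k (s - \<kappa>))))"
proof -
  define L where "L = ln q"
  have L: "L > 0" using q by (simp add: L_def)
  have \<alpha>0: "\<alpha> > 0" using \<alpha> \<kappa> by simp
  \<comment> \<open>The argument of \<open>\<Phi> k\<close> is u itself rather than
    \<open>frac u\<close>: by periodicity the values agree, and continuity of A is then
    evident.\<close>
  define A where "A = (\<lambda>u. \<Sum>k<m. exp (\<kappa> * of_real (L * u)) * of_real u ^ k * \<Phi> k u)"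
  define F where "F = (\<lambda>N. \<Sum>n\<in>{1..<N}. f n)"
  have c\<Phi>: "continuous_on S (\<Phi> k)" if "k < m" for k S
    by (rule holder_continuous_imp_continuous_on[OF holder[OF that] \<alpha>0])
  have cA: "continuous_on S A" for S
    unfolding A_def by (intro continuous_intros c\<Phi>) auto
  have "\<exists>C\<ge>0. \<forall>x\<in>{(u, w). 0 \<le> u \<and> u \<le> w \<and> w \<le> u + 2 / L * exp (- (L * u))}.
      norm (\<Sum>k<m. (\<lambda>(u, w). exp (\<kappa> * of_real (L * w)) * of_real w ^ k * \<Phi> k w - exp (\<kappa> * of_real (L * u)) * of_real u ^ k * \<Phi> k u) x)
         \<le> C * (\<lambda>(u, w). exp (\<kappa>0 * L * u)) x"
  proof (rule norm_sum_le_uniform)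
    fix k assume k: "k < m"
    \<comment> \<open>This is the choice \<beta> = \<open>\<kappa>0 + \<alpha>\<close>, which
      exceeds Re \<kappa> by hypothesis and leaves the exponent \<open>\<kappa>0\<close>.\<close>
    obtain C where "C \<ge> 0" "\<And>u w. 0 \<le> u \<Longrightarrow> u \<le> w \<Longrightarrow> w \<le> u + 2 / L * exp (- (L * u)) \<Longrightarrow>
        norm (exp (\<kappa> * of_real (L * w)) * of_real w ^ k * \<Phi> k w - exp (\<kappa> * of_real (L * u)) * of_real u ^ k * \<Phi> k u)
          \<le> C * exp ((\<kappa>0 + \<alpha> - \<alpha>) * L * u)"
      using exp_power_holder_increment[OF L _ \<alpha>0 \<alpha>(2) holder[OF k] per[OF k], of \<kappa> "\<kappa>0 + \<alpha>" k] \<alpha> by auto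
    then show "\<exists>C\<ge>0. \<forall>x\<in>{(u, w). 0 \<le> u \<and> u \<le> w \<and> w \<le> u + 2 / L * exp (- (L * u))}.
      norm ((\<lambda>(u, w). exp (\<kappa> * of_real (L * w)) * of_real w ^ k * \<Phi> k w - exp (\<kappa> * of_real (L * u)) * of_real u ^ k * \<Phi> k u) x)
         \<le> C * (\<lambda>(u, w). exp (\<kappa>0 * L * u)) x"
      by (intro exI[of _ C]) auto
  qed
  then obtain C1 where C1: "C1 \<ge> 0"
    "\<And>u w. 0 \<le> u \<Longrightarrow> u \<le> w \<Longrightarrow> w \<le> u + 2 / L * exp (- (L * u)) \<Longrightarrow> norm (A w - A u) \<le> C1 * exp (\<kappa>0 * L * u)"
    unfolding A_def by (auto simp: sum_subtractf)
  have A_le: "\<exists>C\<ge>0. \<forall>u\<in>{0..}. norm (A u) \<le> C * exp (\<beta> * L * u)" if \<beta>: "\<beta> > Re \<kappa>" for \<beta>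
    unfolding A_def
  proof (rule norm_sum_le_uniform)
    fix k assume k: "k < m"
    obtain C where C: "C \<ge> 0" "\<And>u. u \<ge> 0 \<Longrightarrow> norm (exp (\<kappa> * of_real (L * u)) * of_real u ^ k) \<le> C * exp (\<beta> * L * u)"
      using norm_exp_power_le[OF L \<beta>, of k] by blast
    obtain B where B: "B > 0" "\<And>x. norm (\<Phi> k x) \<le> B"
      using periodic_continuous_bounded[OF c\<Phi>[OF k] per[OF k]] by blast
    have "norm (exp (\<kappa> * of_real (L * u)) * of_real u ^ k * \<Phi> k u) \<le> C * B * exp (\<beta> * L * u)" if "u \<ge> 0" for u
    proof -
      have "norm (exp (\<kappa> * of_real (L * u)) * of_real u ^ k * \<Phi> k u) \<le> (C * exp (\<beta> * L * u)) * B"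
        unfolding norm_mult[of _ "\<Phi> k u"] using C(1) C(2)[OF that] B by (intro mult_mono) auto
      then show ?thesis by (simp add: mult_ac)
    qed
    then show "\<exists>C\<ge>0. \<forall>u\<in>{0..}. norm (exp (\<kappa> * of_real (L * u)) * of_real u ^ k * \<Phi> k u) \<le> C * exp (\<beta> * L * u)"
      using C(1) B(1) by (intro exI[of _ "C * B"]) auto
  qed
  have "(\<lambda>N. norm (F N - A (log q (real N)))) \<in> O(\<lambda>N. real N powr \<kappa>0)"
  proof -
    have "\<forall>\<^sub>F N::nat in sequentially. norm (F N - A (log q (real N))) = norm ((\<Sum>n\<in>{1..<N}. f n)
         - (\<Sum>k<m. of_nat N powr \<kappa> * of_real (log q (real N)) ^ k * \<Phi> k (frac (log q (real N)))))"
      using eventually_ge_at_top[of 1]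
    proof eventually_elim
      case (elim N)
      have "A (log q (real N)) = (\<Sum>k<m. of_nat N powr \<kappa> * of_real (log q (real N)) ^ k * \<Phi> k (frac (log q (real N))))"
        unfolding A_def
      proof (rule sum.cong)
        fix k assume "k \<in> {..<m}"
        then have "\<Phi> k (frac (log q (real N))) = \<Phi> k (log q (real N))"
          using periodic_frac[of "\<Phi> k"] per by auto
        moreover have "of_nat N powr \<kappa> = exp (\<kappa> * of_real (L * log q (real N)))"
          using elim L by (simp add: powr_def log_def L_def Ln_of_nat)
        ultimately show "exp (\<kappa> * of_real (L * log q (real N))) * of_real (log q (real N)) ^ k * \<Phi> k (log q (real N)) =
            of_nat N powr \<kappa> * of_real (log q (real N)) ^ k * \<Phi> k (frac (log q (real N)))" by simp
      qed simp
      then show ?case by (simp add: F_def)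
    qed
    then show ?thesis using asymp by (subst landau_o.big.in_cong)
  qed
  from bigo_powr_nat_uniform[OF this] obtain C2 where C2: "C2 \<ge> 0"
    "\<And>N. N \<ge> 1 \<Longrightarrow> norm (F N - A (log q (real N))) \<le> C2 * real N powr \<kappa>0" by blast
  \<comment> \<open>F (n + 2) is compared with A at the right endpoint log_q (n + 2), costing C2,
    and A there with A u, costing C1. The factor exp |\<open>\<kappa>0\<close>| rewrites (n +
    2)^\<open>\<kappa>0\<close> in terms of u.\<close>
  define C where "C = C2 * exp \<bar>\<kappa>0\<bar> + C1"
  have C: "C \<ge> 0" using C1 C2 by (simp add: C_def)
  have B_le: "norm (F (n + 2) - A u) \<le> C * exp (\<kappa>0 * ln q * u)"
    if u: "log q (real (Suc n)) \<le> u" "u \<le> log q (real (n + 2))" for n u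
  proof -
    note est = log_Suc_diff_le[OF q u]
    have u0: "u \<ge> 0" using u(1) q by (rule_tac order_trans[OF _ u(1)]) simp
    have u2: "L * u \<le> ln (real (n + 2))" using u(2) L by (simp add: log_def L_def field_simps)
    have "\<kappa>0 * ln (real (n + 2)) \<le> \<kappa>0 * (L * u) + \<bar>\<kappa>0\<bar>"
    proof -
      have "\<kappa>0 * (ln (real (n + 2)) - L * u) \<le> \<bar>\<kappa>0\<bar> * (ln (real (n + 2)) - L * u)"
        using u2 by (intro mult_right_mono) auto
      also have "\<dots> \<le> \<bar>\<kappa>0\<bar> * 1" using est(3) by (intro mult_left_mono) (auto simp: L_def)
      finally show ?thesis by (simp add: algebra_simps)
    qed
    then have "real (n + 2) powr \<kappa>0 \<le> exp \<bar>\<kappa>0\<bar> * exp (\<kappa>0 * L * u)"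
      by (simp add: powr_def mult_ac flip: exp_add)
    then have "C2 * real (n + 2) powr \<kappa>0 \<le> C2 * (exp \<bar>\<kappa>0\<bar> * exp (\<kappa>0 * L * u))" using C2 by (intro mult_left_mono)
    then have 1: "norm (F (n + 2) - A (log q (real (n + 2)))) \<le> C2 * (exp \<bar>\<kappa>0\<bar> * exp (\<kappa>0 * L * u))"
      using C2(2)[of "n + 2"] by linarith
    have 2: "norm (A (log q (real (n + 2))) - A u) \<le> C1 * exp (\<kappa>0 * L * u)"
      using est(1) u(2) u0 by (intro C1(2)) (auto simp: L_def)
    have "norm (F (n + 2) - A u) \<le> norm (F (n + 2) - A (log q (real (n + 2)))) + norm (A (log q (real (n + 2))) - A u)"
      using norm_triangle_ineq[of "F (n + 2) - A (log q (real (n + 2)))" "A (log q (real (n + 2))) - A u"] by simp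
    also have "\<dots> \<le> C * exp (\<kappa>0 * ln q * u)" using 1 2 by (simp add: C_def L_def algebra_simps)
    finally show ?thesis .
  qed
  obtain H where H: "H holomorphic_on {s. Re s > \<kappa>0}"
    "\<And>s. Re s > \<kappa>0 \<Longrightarrow> (\<lambda>n. laplace_segment (ln q) (\<lambda>u. F (n + 2) - A u) (log q (real (Suc n))) (log q (real (n + 2))) s) sums H s"
    by (rule holomorphic_laplace_segment_series[OF q _ C B_le]) (auto intro!: continuous_intros cA)
  have G_eq: "G s = s * of_real (ln q) * (H s + (\<Sum>k<m. T k (s - \<kappa>)))" if s: "Re s > \<sigma>a" for s
  proof -
    have s\<kappa>: "Re s > Re \<kappa>" using s \<sigma>a by simp
    have a_lim: "filterlim (\<lambda>N. log q (real (Suc N))) at_top sequentially"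
    proof -
      have "filterlim (\<lambda>x. ln x / ln q) at_top at_top"
        using filterlim_tendsto_pos_mult_at_top[OF tendsto_const[of "1 / ln q"] _ ln_at_top] L by (simp add: L_def)
      then have "filterlim (log q) at_top at_top" by (simp add: log_def [abs_def])
      then show ?thesis
        by (rule filterlim_compose) (rule filterlim_compose[OF filterlim_real_sequentially filterlim_Suc])
    qed
    have lim0: "(\<lambda>N. F (Suc N) * exp (- (s * of_real (ln (real (Suc N)))))) \<longlonglongrightarrow> 0"
    proof -
      \<comment> \<open>Any exponent strictly between Re \<kappa> and Re s works: F (N) =
        O(N^\<beta>) then makes the boundary term of Abel summation vanish.\<close>
      define \<beta> where "\<beta> = (Re \<kappa> + Re s) / 2"
      have \<beta>: "\<beta> > Re \<kappa>" "\<beta> < Re s" "\<kappa>0 < \<beta>" using s\<kappa> \<kappa> by (auto simp: \<beta>_def field_simps)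
      obtain C' where C': "C' \<ge> 0" "\<And>u. u \<ge> 0 \<Longrightarrow> norm (A u) \<le> C' * exp (\<beta> * L * u)"
        using A_le[OF \<beta>(1)] by auto
      have le: "norm (F (Suc N) * exp (- (s * of_real (ln (real (Suc N)))))) \<le> (C2 + C') * real (Suc N) powr (\<beta> - Re s)" for N
      proof -
        have la: "L * log q (real (Suc N)) = ln (real (Suc N))" using L by (simp add: log_def L_def)
        have "norm (F (Suc N)) \<le> norm (F (Suc N) - A (log q (real (Suc N)))) + norm (A (log q (real (Suc N))))"
          using norm_triangle_ineq[of "F (Suc N) - A (log q (real (Suc N)))" "A (log q (real (Suc N)))"] by simp
        also have "\<dots> \<le> C2 * real (Suc N) powr \<kappa>0 + C' * exp (\<beta> * L * log q (real (Suc N)))"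
          using C2(2)[of "Suc N"] C'(2)[of "log q (real (Suc N))"] q by (intro add_mono) auto
        also have "exp (\<beta> * L * log q (real (Suc N))) = real (Suc N) powr \<beta>"
          by (simp only: mult.assoc la) (simp add: powr_def)
        also have "C2 * real (Suc N) powr \<kappa>0 \<le> C2 * real (Suc N) powr \<beta>"
          using C2 \<beta> by (intro mult_left_mono powr_mono) auto
        finally have F_le: "norm (F (Suc N)) \<le> (C2 + C') * real (Suc N) powr \<beta>" by (simp add: algebra_simps)
        have "norm (exp (- (s * of_real (ln (real (Suc N)))))) = real (Suc N) powr (- Re s)"
          by (simp add: powr_def)
        then have "norm (F (Suc N) * exp (- (s * of_real (ln (real (Suc N)))))) \<le> ((C2 + C') * real (Suc N) powr \<beta>) * real (Suc N) powr (- Re s)"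
          unfolding norm_mult using F_le by (simp only: mult_right_mono powr_ge_zero)
        also have "\<dots> = (C2 + C') * real (Suc N) powr (\<beta> - Re s)"
          by (simp only: mult.assoc powr_add [symmetric]) simp
        finally show ?thesis .
      qed
      have lim: "(\<lambda>N. (C2 + C') * real (Suc N) powr (\<beta> - Re s)) \<longlonglongrightarrow> 0"
      proof (rule tendsto_mult_right_zero)
        show "(\<lambda>N. real (Suc N) powr (\<beta> - Re s)) \<longlonglongrightarrow> 0"
          using \<beta> by (intro tendsto_neg_powr filterlim_compose[OF filterlim_real_sequentially filterlim_Suc]) auto
      qed
      show ?thesis by (rule Lim_null_comparison[OF always_eventually[OF allI[OF le]] lim])
    qed
    have "((\<lambda>U. \<Sum>k<m. laplace_segment L (\<lambda>u. of_real u ^ k * \<Phi> k u) 0 U (s - \<kappa>)) \<longlongrightarrow> (\<Sum>k<m. T k (s - \<kappa>))) at_top"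
      unfolding L_def by (intro tendsto_sum T) (use s\<kappa> in auto)
    moreover have "(\<Sum>k<m. laplace_segment L (\<lambda>u. of_real u ^ k * \<Phi> k u) 0 U (s - \<kappa>)) = laplace_segment L A 0 U s" for U
    proof -
      have "laplace_segment L A 0 U s = integral {0..U} (\<lambda>u. \<Sum>k<m. of_real u ^ k * \<Phi> k u * exp (- ((s - \<kappa>) * of_real (L * u))))"
      proof -
        have E: "exp (- ((s - \<kappa>) * x)) = exp (\<kappa> * x) * exp (- (s * x))" for x
          by (simp add: left_diff_distrib flip: exp_add)
        then show ?thesis
          unfolding laplace_segment_def A_def sum_distrib_right E
          by (intro integral_cong sum.cong refl) (simp only: mult_ac)
      qed
      also have "\<dots> = (\<Sum>k<m. laplace_segment L (\<lambda>u. of_real u ^ k * \<Phi> k u) 0 U (s - \<kappa>))"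
        unfolding laplace_segment_def
        by (intro integral_sum integrable_continuous_real continuous_intros c\<Phi>) auto
      finally show ?thesis ..
    qed
    ultimately have "((\<lambda>U. laplace_segment L A 0 U s) \<longlongrightarrow> (\<Sum>k<m. T k (s - \<kappa>))) at_top" by simp
    from filterlim_compose[OF this a_lim] have lim1: "(\<lambda>N. laplace_segment L A 0 (log q (real (Suc N))) s) \<longlonglongrightarrow> (\<Sum>k<m. T k (s - \<kappa>))" .
    have lim2: "(\<lambda>N. \<Sum>n<N. laplace_segment (ln q) (\<lambda>u. F (n + 2) - A u) (log q (real (Suc n))) (log q (real (n + 2))) s) \<longlonglongrightarrow> H s"
      using H(2)[of s] s\<kappa> \<kappa> by (simp add: sums_def)
    have "(\<lambda>N. \<Sum>n<N. f (Suc n) / of_nat (Suc n) powr s) \<longlonglongrightarrow> 0 + s * of_real (ln q) * (H s + (\<Sum>k<m. T k (s - \<kappa>)))"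
      unfolding abel_summation_laplace[OF q cA]
      by (intro tendsto_add tendsto_mult tendsto_const lim0[unfolded F_def] lim1[unfolded L_def] lim2[unfolded F_def])
    moreover have "(\<lambda>N. \<Sum>n<N. f (Suc n) / of_nat (Suc n) powr s) \<longlonglongrightarrow> G s"
      using G[OF s] by (simp add: sums_def)
    ultimately show ?thesis using LIMSEQ_unique by fastforce
  qed
  show ?thesis by (intro exI[of _ H] conjI allI impI H(1) G_eq)
qed

section \<open>Residues of the Dirichlet series\<close>

text \<open>The residue is a Taylor coefficient of (s - p)^j at p: for j < k the k-th derivative is
  zero, for j > k it vanishes at p. This isolates one index k in the sum of pure poles.\<close>

lemma residue_power_quotient:
  "residue (\<lambda>s. c * (s - p) ^ j / (s - p) ^ Suc k) p = (if j = k then c else 0)"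
proof -
  have hol: "(\<lambda>s. (s - p) ^ j) holomorphic_on UNIV" by (intro holomorphic_intros)
  have "residue (\<lambda>s. c * (s - p) ^ j / (s - p) ^ Suc k) p = (deriv ^^ k) (\<lambda>s. c * (s - p) ^ j) p / fact k"
    by (rule residue_holomorphic_over_power[of UNIV]) (auto intro!: holomorphic_intros)
  also have "(deriv ^^ k) (\<lambda>s. c * (s - p) ^ j) p = c * (deriv ^^ k) (\<lambda>s. (s - p) ^ j) p"
    by (rule higher_deriv_cmult[OF hol]) auto
  also have "(deriv ^^ k) (\<lambda>s. (s - p) ^ j) p = (if j = k then fact k else 0)"
  proof -
    consider "j = k" | "k < j" | "j < k" by linarith
    then show ?thesis
      unfolding higher_deriv_power
      by cases (auto simp: pochhammer_fact pochhammer_0_left)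
  qed
  finally show ?thesis by simp
qed

lemma residue_sum:
  assumes "finite I" "open S" "p \<in> S" "\<And>i. i \<in> I \<Longrightarrow> f i holomorphic_on S - {p}"
  shows "residue (\<lambda>s. \<Sum>i\<in>I. f i s) p = (\<Sum>i\<in>I. residue (f i) p)"
  using assms(1,4)
proof (induction I)
  case empty
  then show ?case by (simp add: residue_const)
next
  case (insert i I)
  then show ?case
    by (simp add: residue_add[OF assms(2,3)] holomorphic_on_sum)
qed

text \<open>The spacing of the candidate poles; a disc of this radius around one of them contains no
  other.\<close>

lemma dist_chi:
  assumes "q > 1" "i \<noteq> j"
  shows "norm (chi q i - chi q j) \<ge> 2 * pi / ln q"
proof -
  have L: "ln q > 0" using assms by simp
  have "chi q i - chi q j = of_real (2 * pi / ln q) * \<i> * of_int (i - j)"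
    using L by (simp add: chi_def field_simps)
  then have "norm (chi q i - chi q j) = 2 * pi / ln q * \<bar>real_of_int (i - j)\<bar>"
    using L by (simp only: norm_mult norm_of_real norm_of_int) simp
  moreover have "\<bar>real_of_int (i - j)\<bar> \<ge> 1" using assms(2) by linarith
  ultimately show ?thesis using L by (simp add: divide_right_mono field_simps)
qed

text \<open>The two-sided Fourier series is read as the limit of symmetric partial sums, since a
  Hoelder exponent of at most 1/2 does not ensure absolute convergence.\<close>

theorem theoremA6:
  fixes f :: "nat \<Rightarrow> complex" and \<kappa> :: complex and \<kappa>0 \<delta> q \<alpha> \<sigma>a \<eta> :: real
    and m :: nat and \<Phi> :: "nat \<Rightarrow> real \<Rightarrow> complex" and G :: "complex \<Rightarrow> complex"
  assumes k0: "\<kappa>0 \<noteq> 0" "-1 < \<kappa>0" "\<kappa>0 < Re \<kappa>"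
    and delta: "0 < \<delta>" "\<delta> \<le> pi / ln q" "\<delta> < Re \<kappa> - \<kappa>0"
    and q: "1 < q"
    and m: "0 < m"
    and alpha: "Re \<kappa> - \<kappa>0 < \<alpha>" "\<alpha> \<le> 1"
    and periodic: "\<And>k u. k < m \<Longrightarrow> \<Phi> k (u + 1) = \<Phi> k u"
    and holder: "\<And>k. k < m \<Longrightarrow> holder_continuous \<alpha> (\<Phi> k)"
    and asymp: "(\<lambda>N::nat. norm ((\<Sum>n\<in>{1..<N}. f n)
                   - (\<Sum>k<m. of_nat N powr \<kappa> * of_real (log q (real N)) ^ k
                              * \<Phi> k (frac (log q (real N))))))
               \<in> O(\<lambda>N. real N powr \<kappa>0)"
    (* (i) absolute convergence for Re s > sigma_a; G is the Dirichlet series there *)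
    and sigma: "Re \<kappa> \<le> \<sigma>a"
    and absconv: "\<And>s. Re s > \<sigma>a \<Longrightarrow>
                     summable (\<lambda>n. norm (f (Suc n) / of_nat (Suc n) powr s))"
    and cont: "\<And>s. Re s > \<sigma>a \<Longrightarrow> G s = (\<Sum>n. f (Suc n) / of_nat (Suc n) powr s)"
    (* (ii) meromorphic continuation to Re s > kappa0 - delta, poles only at kappa + chi_l, order \<le> m *)
    and holo: "G holomorphic_on ({s. Re s > \<kappa>0 - \<delta>} - range (\<lambda>l. \<kappa> + chi q l))"
    and nonessential: "\<And>l. not_essential G (\<kappa> + chi q l)"
    and poleorder: "\<And>l. is_pole G (\<kappa> + chi q l) \<Longrightarrow> zorder G (\<kappa> + chi q l) \<ge> - int m"
    (* (iii) polynomial growth *)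
    and eta: "0 < \<eta>"
    and growth: "\<exists>C T. \<forall>s. \<kappa>0 \<le> Re s \<and> Re s \<le> \<sigma>a
                   \<and> (\<forall>l. cmod (s - \<kappa> - chi q l) \<ge> \<delta>) \<and> \<bar>Im s\<bar> \<ge> T
                   \<longrightarrow> norm (G s) \<le> C * \<bar>Im s\<bar> powr \<eta>"
  shows "(\<forall>k<m. \<forall>u::real.
            (\<lambda>L::nat. \<Sum>l\<in>{-int L..int L}.
                 (of_real (ln q) ^ k / of_nat (fact k)
                   * residue (\<lambda>s. G s * (s - \<kappa> - chi q l) ^ k / s) (\<kappa> + chi q l))
                 * exp (2 * of_int l * pi * \<i> * of_real u))
            \<longlonglongrightarrow> \<Phi> k u)
         \<and> ((-1 < \<kappa>0 \<and> \<kappa>0 < 0 \<and> \<kappa> \<notin> range (chi q)) \<longrightarrow> G 0 = 0)"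
proof -
  have \<alpha>0: "\<alpha> > 0" using alpha k0 by simp
  have lnq: "ln q > 0" using q by simp
  have c\<Phi>: "continuous_on UNIV (\<Phi> k)" if "k < m" for k
    by (rule holder_continuous_imp_continuous_on[OF holder[OF that] \<alpha>0])
  have "\<forall>k\<in>{..<m}. \<exists>T. T holomorphic_on - range (chi q) \<and>
     (\<forall>z. Re z > 0 \<longrightarrow> ((\<lambda>U. laplace_segment (ln q) (\<lambda>u. of_real u ^ k * \<Phi> k u) 0 U z) \<longlongrightarrow> T z) at_top) \<and>
     (\<forall>l. \<exists>r e. r > 0 \<and> e holomorphic_on ball (chi q l) r \<and> (\<forall>z \<in> ball (chi q l) r - {chi q l}.
        T z = fact k * fourier_coeff (\<Phi> k) l / of_real (ln q) ^ Suc k / (z - chi q l) ^ Suc k + e z))"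
  proof
    fix k assume "k \<in> {..<m}"
    then have k: "k < m" by simp
    show "\<exists>T. T holomorphic_on - range (chi q) \<and>
     (\<forall>z. Re z > 0 \<longrightarrow> ((\<lambda>U. laplace_segment (ln q) (\<lambda>u. of_real u ^ k * \<Phi> k u) 0 U z) \<longlongrightarrow> T z) at_top) \<and>
     (\<forall>l. \<exists>r e. r > 0 \<and> e holomorphic_on ball (chi q l) r \<and> (\<forall>z \<in> ball (chi q l) r - {chi q l}.
        T z = fact k * fourier_coeff (\<Phi> k) l / of_real (ln q) ^ Suc k / (z - chi q l) ^ Suc k + e z))"
      by (rule periodic_laplace_continuation[OF q c\<Phi>[OF k] periodic[OF k], where k = k]) blast
  qed
  from bchoice[OF this] obtain T where T: "\<forall>k\<in>{..<m}. T k holomorphic_on - range (chi q) \<and>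
     (\<forall>z. Re z > 0 \<longrightarrow> ((\<lambda>U. laplace_segment (ln q) (\<lambda>u. of_real u ^ k * \<Phi> k u) 0 U z) \<longlongrightarrow> T k z) at_top) \<and>
     (\<forall>l. \<exists>r e. r > 0 \<and> e holomorphic_on ball (chi q l) r \<and> (\<forall>z \<in> ball (chi q l) r - {chi q l}.
        T k z = fact k * fourier_coeff (\<Phi> k) l / of_real (ln q) ^ Suc k / (z - chi q l) ^ Suc k + e z))" ..
  have T_hol: "T k holomorphic_on - range (chi q)" if "k < m" for k
    by (rule bspec[OF T, THEN conjunct1]) (use that in simp)
  have T_lim: "((\<lambda>U. laplace_segment (ln q) (\<lambda>u. of_real u ^ k * \<Phi> k u) 0 U z) \<longlongrightarrow> T k z) at_top"
    if "k < m" "Re z > 0" for k z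
    by (rule bspec[OF T, THEN conjunct2, THEN conjunct1, THEN spec, THEN mp]) (use that in simp_all)
  have T_pole: "\<exists>r e. r > 0 \<and> e holomorphic_on ball (chi q l) r \<and> (\<forall>z \<in> ball (chi q l) r - {chi q l}.
        T k z = fact k * fourier_coeff (\<Phi> k) l / of_real (ln q) ^ Suc k / (z - chi q l) ^ Suc k + e z)"
    if "k < m" for k l
    by (rule bspec[OF T, THEN conjunct2, THEN conjunct2, THEN spec]) (use that in simp)
  have sums: "(\<lambda>n. f (Suc n) / of_nat (Suc n) powr s) sums G s" if "Re s > \<sigma>a" for s
    unfolding cont[OF that] by (rule summable_sums[OF summable_norm_cancel[OF absconv[OF that]]])
  have "\<exists>H. H holomorphic_on {s. Re s > \<kappa>0} \<and>
          (\<forall>s. Re s > \<sigma>a \<longrightarrow> G s = s * of_real (ln q) * (H s + (\<Sum>k<m. T k (s - \<kappa>))))"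
    by (rule dirichlet_series_continuation[OF q k0(3) alpha periodic holder asymp sums sigma T_lim])
  then obtain H where HG: "H holomorphic_on {s. Re s > \<kappa>0} \<and>
          (\<forall>s. Re s > \<sigma>a \<longrightarrow> G s = s * of_real (ln q) * (H s + (\<Sum>k<m. T k (s - \<kappa>))))" ..
  have H: "H holomorphic_on {s. Re s > \<kappa>0}" using HG ..
  have G_eq: "G s = s * of_real (ln q) * (H s + (\<Sum>k<m. T k (s - \<kappa>)))" if "Re s > \<sigma>a" for s
    by (rule HG[THEN conjunct2, THEN spec, THEN mp, OF that])
  define P where "P = range (\<lambda>l. \<kappa> + chi q l)"
  have Re_chi: "Re (chi q l) = 0" for l by (simp add: chi_def)
  have P_iff: "s \<in> P \<longleftrightarrow> s - \<kappa> \<in> range (chi q)" for s by (auto simp: P_def image_iff algebra_simps)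
  have "P = (+) \<kappa> ` range (chi q)" by (auto simp: P_def)
  then have P_closed: "closed P" using closed_translation[OF closed_range_chi[OF q]] by simp
  have G_eq': "G s = s * of_real (ln q) * (H s + (\<Sum>k<m. T k (s - \<kappa>)))" if "Re s > \<kappa>0" "s \<notin> P" for s
  proof (rule analytic_continuation_open[of "{s. Re s > \<sigma>a}" "{s. Re s > \<kappa>0} - P" G])
    show "{s. Re s > \<sigma>a} \<noteq> {}" by (auto intro!: exI[of _ "of_real (\<sigma>a + 1)"])
    \<comment> \<open>Removing countably many points from an open connected set of the plane leaves
      it connected, so the identity theorem carries the formula from Re s > \<open>\<sigma>a\<close>
      to all of Re s > \<open>\<kappa>0\<close> off the poles.\<close>
    show "connected ({s. Re s > \<kappa>0} - P)"
      by (rule connected_open_diff_countable)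
         (auto simp: P_def open_halfspace_Re_gt intro!: convex_connected convex_halfspace_Re_gt)
    show "{s. Re s > \<sigma>a} \<subseteq> {s. Re s > \<kappa>0} - P"
      using sigma k0 Re_chi by (auto simp: P_def)
    show "G holomorphic_on {s. Re s > \<kappa>0} - P"
      using holo unfolding P_def by (rule holomorphic_on_subset) (use delta in auto)
    show "(\<lambda>s. s * of_real (ln q) * (H s + (\<Sum>k<m. T k (s - \<kappa>)))) holomorphic_on {s. Re s > \<kappa>0} - P"
    proof (intro holomorphic_intros)
      show "H holomorphic_on {s. Re s > \<kappa>0} - P" using H by (rule holomorphic_on_subset) auto
      fix k assume "k \<in> {..<m}"
      then have "T k holomorphic_on - range (chi q)" using T_hol by auto
      then have "(T k \<circ> (\<lambda>s. s - \<kappa>)) holomorphic_on {s. Re s > \<kappa>0} - P"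
        by (rule holomorphic_on_compose_gen[rotated]) (auto simp: P_iff intro!: holomorphic_intros)
      then show "(\<lambda>s. T k (s - \<kappa>)) holomorphic_on {s. Re s > \<kappa>0} - P" by (simp add: o_def)
    qed
  qed (use that G_eq P_closed in \<open>auto intro: open_halfspace_Re_gt open_Diff\<close>)
  have coeff: "of_real (ln q) ^ j / of_nat (fact j)
       * residue (\<lambda>s. G s * (s - \<kappa> - chi q l) ^ j / s) (\<kappa> + chi q l) = fourier_coeff (\<Phi> j) l"
    if j: "j < m" for j l
  proof -
    define p where "p = \<kappa> + chi q l"
    define a where "a = (\<lambda>k. fact k * fourier_coeff (\<Phi> k) l / of_real (ln q) ^ Suc k)"
    have "\<forall>k\<in>{..<m}. \<exists>r e. r > 0 \<and> e holomorphic_on ball (chi q l) r \<and>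
            (\<forall>z \<in> ball (chi q l) r - {chi q l}. T k z = a k / (z - chi q l) ^ Suc k + e z)"
      unfolding a_def by (intro ballI T_pole) simp
    from bchoice[OF this] obtain r where r: "\<forall>k\<in>{..<m}. \<exists>e. r k > 0 \<and> e holomorphic_on ball (chi q l) (r k) \<and>
            (\<forall>z \<in> ball (chi q l) (r k) - {chi q l}. T k z = a k / (z - chi q l) ^ Suc k + e z)" ..
    from bchoice[OF this] obtain e where e: "\<forall>k\<in>{..<m}. r k > 0 \<and> e k holomorphic_on ball (chi q l) (r k) \<and>
            (\<forall>z \<in> ball (chi q l) (r k) - {chi q l}. T k z = a k / (z - chi q l) ^ Suc k + e k z)" ..
    have re: "r k > 0" "e k holomorphic_on ball (chi q l) (r k)"
      "\<forall>z \<in> ball (chi q l) (r k) - {chi q l}. T k z = a k / (z - chi q l) ^ Suc k + e k z" if "k < m" for k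
      by (rule bspec[OF e, THEN conjunct1] bspec[OF e, THEN conjunct2, THEN conjunct1] bspec[OF e, THEN conjunct2, THEN conjunct2];
          use that in simp)+
    \<comment> \<open>The three bounds keep the disc free of other poles, inside Re s >
      \<open>\<kappa>0\<close>, and inside the domains of all m local expansions.\<close>
    define R where "R = Min (insert (2 * pi / ln q) (insert (Re \<kappa> - \<kappa>0) (r ` {..<m})))"
    have R: "R > 0" "R \<le> 2 * pi / ln q" "R \<le> Re \<kappa> - \<kappa>0" "\<And>k. k < m \<Longrightarrow> R \<le> r k"
      unfolding R_def using re(1) lnq k0 by (auto intro!: Min_le simp del: Min_insert)
    have ball: "Re s > \<kappa>0" "s \<noteq> p \<Longrightarrow> s \<notin> P" "k < m \<Longrightarrow> s - \<kappa> \<in> ball (chi q l) (r k)" if s: "s \<in> ball p R" for s k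
    proof -
      have d: "norm (p - s) < R" using s by (simp add: dist_norm)
      have "\<bar>Re (p - s)\<bar> < R" using abs_Re_le_cmod d by (rule le_less_trans)
      then show "Re s > \<kappa>0" using R(3) Re_chi[of l] by (auto simp: p_def)
      show "s \<notin> P" if "s \<noteq> p"
      proof
        assume "s \<in> P"
        then obtain i where i: "s = \<kappa> + chi q i" by (auto simp: P_def)
        then have "norm (chi q l - chi q i) < 2 * pi / ln q" using d R(2) by (simp add: p_def)
        then have "i = l" using dist_chi[OF q, of l i] by force
        then show False using i that by (simp add: p_def)
      qed
      show "s - \<kappa> \<in> ball (chi q l) (r k)" if "k < m"
        using d R(4)[OF that] by (simp add: p_def dist_norm algebra_simps)
    qed
    \<comment> \<open>N is the holomorphic and the sum of the \<open>D k\<close> the polar part of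
      the function whose residue is wanted, after the factor s of G has cancelled the division by
      s.\<close>
    define N where "N = (\<lambda>s. of_real (ln q) * (s - p) ^ j * (H s + (\<Sum>k<m. e k (s - \<kappa>))))"
    define D where "D = (\<lambda>k s. of_real (ln q) * a k * (s - p) ^ j / (s - p) ^ Suc k)"
    have N_hol: "N holomorphic_on ball p R"
      unfolding N_def
    proof (intro holomorphic_intros)
      show "H holomorphic_on ball p R" using H by (rule holomorphic_on_subset) (use ball(1) in auto)
      fix k assume "k \<in> {..<m}"
      then have k: "k < m" by simp
      have "(\<lambda>s. s - \<kappa>) ` ball p R \<subseteq> ball (chi q l) (r k)" using ball(3)[OF _ k] by blast
      then have "(e k \<circ> (\<lambda>s. s - \<kappa>)) holomorphic_on ball p R"
        by (intro holomorphic_on_compose_gen[OF _ re(2)[OF k]] holomorphic_intros)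
      then show "(\<lambda>s. e k (s - \<kappa>)) holomorphic_on ball p R" by (simp add: o_def)
    qed
    have D_hol: "D k holomorphic_on ball p R - {p}" for k
      unfolding D_def by (intro holomorphic_intros) auto
    have "\<forall>\<^sub>F s in at p. s \<in> ball p R - {p}" using R(1) by (intro eventually_at_in_open) auto
    \<comment> \<open>This holds also for p = 0, because the filter excludes p itself; hence
      cancelling s is legitimate near every p.\<close>
    moreover have "\<forall>\<^sub>F s in at p. s \<noteq> 0"
      by (rule eventually_neq_at_within)
    ultimately have "\<forall>\<^sub>F s in at p. G s * (s - \<kappa> - chi q l) ^ j / s = N s + (\<Sum>k<m. D k s)"
    proof eventually_elim
      case (elim s)
      have "G s = s * of_real (ln q) * (H s + (\<Sum>k<m. T k (s - \<kappa>)))"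
        using elim ball[of s] by (intro G_eq') auto
      also have "(\<Sum>k<m. T k (s - \<kappa>)) = (\<Sum>k<m. a k / (s - p) ^ Suc k + e k (s - \<kappa>))"
      proof (rule sum.cong)
        fix k assume "k \<in> {..<m}"
        then show "T k (s - \<kappa>) = a k / (s - p) ^ Suc k + e k (s - \<kappa>)"
          using bspec[OF re(3)[of k], of "s - \<kappa>"] ball(3)[of s k] elim
          by (simp add: p_def algebra_simps del: power_Suc)
      qed simp
      finally have "G s * (s - p) ^ j / s =
          of_real (ln q) * (H s + (\<Sum>k<m. a k / (s - p) ^ Suc k + e k (s - \<kappa>))) * (s - p) ^ j"
        using elim by simp
      also have "\<dots> = N s + (\<Sum>k<m. D k s)"
        by (simp add: N_def D_def sum.distrib sum_distrib_left sum_distrib_right algebra_simps del: power_Suc)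
      finally show ?case by (simp add: p_def diff_diff_eq)
    qed
    then have "residue (\<lambda>s. G s * (s - \<kappa> - chi q l) ^ j / s) p = residue (\<lambda>s. N s + (\<Sum>k<m. D k s)) p"
      by (rule residue_cong) simp
    also have "\<dots> = residue N p + residue (\<lambda>s. \<Sum>k<m. D k s) p"
      using R(1) by (intro residue_add[of "ball p R"] holomorphic_on_sum D_hol holomorphic_on_subset[OF N_hol]) auto
    also have "residue N p = 0"
      using R(1) by (intro residue_holo[OF _ _ N_hol]) auto
    also have "residue (\<lambda>s. \<Sum>k<m. D k s) p = (\<Sum>k<m. residue (D k) p)"
      using R(1) by (intro residue_sum[of _ "ball p R"] D_hol) auto
    \<comment> \<open>Only k = j contributes. As a j is j! times the Fourier coefficient over
      L^(j+1), the prefactor L^j / j! leaves exactly that coefficient.\<close>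
    also have "\<dots> = of_real (ln q) * a j"
      using j unfolding D_def residue_power_quotient by simp
    finally show ?thesis unfolding p_def using lnq by (simp add: a_def field_simps)
  qed
  show ?thesis
  proof (intro conjI allI impI)
    fix k u assume k: "k < m"
    show "(\<lambda>L::nat. \<Sum>l\<in>{-int L..int L}.
                 (of_real (ln q) ^ k / of_nat (fact k)
                   * residue (\<lambda>s. G s * (s - \<kappa> - chi q l) ^ k / s) (\<kappa> + chi q l))
                 * exp (2 * of_int l * pi * \<i> * of_real u))
            \<longlonglongrightarrow> \<Phi> k u"
      unfolding coeff[OF k] by (rule fourier_series_holder[OF holder[OF k] \<alpha>0 periodic[OF k]])
  next
    assume *: "- 1 < \<kappa>0 \<and> \<kappa>0 < 0 \<and> \<kappa> \<notin> range (chi q)"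
    \<comment> \<open>With \<open>\<kappa>0\<close> < 0 the point 0 lies in the half-plane of the
      explicit formula; off the poles its factor s then forces the value 0.\<close>
    have "0 \<notin> P"
    proof
      assume "0 \<in> P"
      then obtain l where "0 = \<kappa> + chi q l" by (auto simp: P_def)
      then have "\<kappa> = chi q (- l)" by (simp add: chi_def eq_neg_iff_add_eq_0)
      then show False using * by blast
    qed
    then show "G 0 = 0" using G_eq'[of 0] * by simp
  qed
qed

end
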